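(* For every prime $p\equiv 7\pmod{12}$ and for every $p\in\{37,61,73,109,157,181,229,277\}$, there exist a strictly $p$-cyclic $SQS(2\times p)$ and a perfect 2-D $(2\times p,4,2)$-OOC.
   Context: A strictly $v$-cyclic $SQS(u\times v)$ is a set of $4$-subsets (blocks) of $I_u\times Z_v$ ($I_u=\{0,\dots,u-1\}$) such that every $3$-subset is in exactly one block, invariant under $(i,x)\mapsto(i,x+1)$, and no block $B$ satisfies $B+\delta=B$ for nonzero $\delta\in Z_v$. A 2-D $(u\times v,4,2)$-OOC is a family of $u\times v$ $(0,1)$-matrices of weight $4$ such that for all codewords $A=(a_{ij}),B=(b_{ij})$ and integers $r$ with $A\ne B$ or $r\not\equiv0\pmod v$, $\sum_{i,j}a_{ij}b_{i,j+r}\le2$ (columns mod $v$); it is perfect if it has $u(uv-1)(uv-2)/24$ codewords. *)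

theory Defs
  imports "HOL-Computational_Algebra.Primes"
begin

text \<open>Point set I_u x Z_v, with Z_v represented by {0..<v}.\<close>
definition pts :: "nat \<Rightarrow> nat \<Rightarrow> (nat \<times> nat) set" where
  "pts u v = {0..<u} \<times> {0..<v}"

definition shiftv :: "nat \<Rightarrow> nat \<Rightarrow> (nat \<times> nat) set \<Rightarrow> (nat \<times> nat) set" where
  "shiftv v d B = (\<lambda>(i, x). (i, (x + d) mod v)) ` B"

definition SQS :: "nat \<Rightarrow> nat \<Rightarrow> (nat \<times> nat) set set \<Rightarrow> bool" where
  "SQS u v S \<longleftrightarrow>
     (\<forall>B\<in>S. B \<subseteq> pts u v \<and> card B = 4) \<and>
     (\<forall>T. T \<subseteq> pts u v \<and> card T = 3 \<longrightarrow> (\<exists>!B. B \<in> S \<and> T \<subseteq> B))"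

definition strictly_cyclic_SQS :: "nat \<Rightarrow> nat \<Rightarrow> (nat \<times> nat) set set \<Rightarrow> bool" where
  "strictly_cyclic_SQS u v S \<longleftrightarrow>
     SQS u v S \<and>
     (\<forall>B\<in>S. shiftv v 1 B \<in> S) \<and>
     (\<forall>B\<in>S. \<forall>d. 0 < d \<and> d < v \<longrightarrow> shiftv v d B \<noteq> B)"

text \<open>A u x v (0,1)-matrix is represented by the set of positions (i,j) of its 1-entries.
  The correlation sum_{i,j} a_ij b_{i,j+r} (columns mod v) is the number of
  1-positions (i,j) of A such that (i,(j+r) mod v) is a 1-position of B.\<close>
definition corr :: "nat \<Rightarrow> (nat \<times> nat) set \<Rightarrow> (nat \<times> nat) set \<Rightarrow> int \<Rightarrow> nat" where
  "corr v A B r = card {(i, j). (i, j) \<in> A \<and> (i, nat ((int j + r) mod int v)) \<in> B}"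

definition OOC2D :: "nat \<Rightarrow> nat \<Rightarrow> (nat \<times> nat) set set \<Rightarrow> bool" where
  "OOC2D u v C \<longleftrightarrow>
     (\<forall>A\<in>C. A \<subseteq> pts u v \<and> card A = 4) \<and>
     (\<forall>A\<in>C. \<forall>B\<in>C. \<forall>r::int. (A \<noteq> B \<or> r mod int v \<noteq> 0) \<longrightarrow> corr v A B r \<le> 2)"

definition perfect_OOC2D :: "nat \<Rightarrow> nat \<Rightarrow> (nat \<times> nat) set set \<Rightarrow> bool" where
  "perfect_OOC2D u v C \<longleftrightarrow>
     OOC2D u v C \<and> card C = u * (u * v - 1) * (u * v - 2) div 24"

end

theory Submission
  imports Defs "HOL-Number_Theory.Number_Theory"
begin

text \<open>
  A totally symmetric quaternary relation in which any three distinct points have exactly one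
  completion is a Steiner quadruple system.  On two copies of \<open>Z\<^sub>p\<close>, the second one carrying the
  negatives of the blocks of the first, such a relation is given by three relations on \<open>Z\<^sub>p\<close>:
  \<open>K\<close> for blocks inside one row, \<open>D\<close> for blocks \<open>{x, y, z}\<^sub>0 {w}\<^sub>1\<close>, and \<open>M\<close> for blocks
  \<open>{x, y}\<^sub>0 {c, d}\<^sub>1\<close>.

  For \<open>p = 7 (mod 12)\<close> let \<open>e\<close> be a primitive sixth root of unity.  The quadruples of
  \<open>Z\<^sub>p \<union> {\<infinity>}\<close> with cross ratio \<open>e\<close>, oriented by the quadratic character (\<open>- 1\<close> is a
  nonresidue), form a \<open>PSL(2,p)\<close>-invariant quadruple system.  Its blocks avoiding \<open>\<infinity>\<close> are \<open>K\<close>.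
  Its blocks through \<open>\<infinity>\<close> are the equilateral triangles \<open>{x, y, z}\<close>; in \<open>D\<close> they are completed by the
  centre \<open>w\<close> in the other row.  The remaining points \<open>w + j (y - x)\<close> of that row, \<open>0 < j < p\<close>,
  are paired consecutively in \<open>M\<close>.

  For the eight exceptional primes, \<open>M\<close> consists of the harmonic quadruples, \<open>D\<close> of the arithmetic
  progressions \<open>{x - t, x, x + t}\<^sub>0 {x}\<^sub>1\<close>, and \<open>K\<close> is an explicit family invariant under the affine
  group: the orbit of \<open>{0, 1, e, (1 + e) / 3}\<close> together with orbits of quadruples
  \<open>{0, 1, a, 1 - a}\<close>, found as a perfect matching of a cubic graph on the orbits of triples.

  Since \<open>p > 4\<close>, no block is fixed by a translation, and representatives of the translation orbits
  form a perfect code.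
\<close>

section \<open>Quadruple systems from symmetric relations\<close>

text \<open>Adjacent transpositions generate all permutations of the arguments. Instead of listing
  24 orders, \<open>x\<close> is brought to the first place and \<open>y\<close> to the second; only
  the order of the last two then remains open.\<close>

lemma totally_symmetric_quadruple:
  assumes swap: "\<And>a b c d. R a b c d \<Longrightarrow> R b a c d" "\<And>a b c d. R a b c d \<Longrightarrow> R a c b d"
      "\<And>a b c d. R a b c d \<Longrightarrow> R a b d c"
    and "R a b c d" "{a, b, c, d} = {x, y, z, w}" "distinct [x, y, z, w]"
  shows "R x y z w"
proof -
  have front: "\<exists>f' g' h'. R e' f' g' h' \<and> {e', f', g', h'} = {e, f, g, h}"
    if "R e f g h" "e' \<in> {e, f, g, h}" for e f g h e'
  proof -
    have "R f e g h" "R g e f h" "R h e f g" using swap that(1) by blast+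
    then show ?thesis using that by (elim insertE emptyE) (use insert_commute in fast)+
  qed
  have second: "\<exists>g' h'. R e f' g' h' \<and> {e, f', g', h'} = {e, f, g, h}"
    if "R e f g h" "f' \<in> {f, g, h}" for e f g h f'
  proof -
    have "R e g f h" "R e h f g" using swap that(1) by blast+
    then show ?thesis using that by (elim insertE emptyE) (use insert_commute in fast)+
  qed
  obtain b1 c1 d1 where 1: "R x b1 c1 d1" "{x, b1, c1, d1} = {x, y, z, w}"
    using front[OF assms(4), of x] assms(5) by auto
  have "y \<in> {b1, c1, d1}" using 1(2) assms(6) by auto
  then obtain c2 d2 where 2: "R x y c2 d2" "{x, y, c2, d2} = {x, y, z, w}"
    using second[OF 1(1)] 1(2) by metis
  have "c2 = z \<and> d2 = w \<or> c2 = w \<and> d2 = z"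
  proof -
    have "z \<in> {x, y, c2, d2}" "w \<in> {x, y, c2, d2}" unfolding 2(2) by simp_all
    then show ?thesis using assms(6) by auto
  qed
  then show ?thesis using 2(1) swap(3) by blast
qed

text \<open>Irreflexivity in the last two places spreads to all pairs by symmetry, so blocks have
  four points. Uniqueness is asked only for completions in \<open>pts u v\<close>, because
  \<open>R\<close> may read coordinates modulo \<open>v\<close> and so also hold for points
  outside.\<close>

lemma SQS_of_relation:
  fixes R :: "nat \<times> nat \<Rightarrow> nat \<times> nat \<Rightarrow> nat \<times> nat \<Rightarrow> nat \<times> nat \<Rightarrow> bool"
  assumes swap: "\<And>a b c d. R a b c d \<Longrightarrow> R b a c d" "\<And>a b c d. R a b c d \<Longrightarrow> R a c b d"
      "\<And>a b c d. R a b c d \<Longrightarrow> R a b d c"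
    and irrefl: "\<And>a b c d. R a b c d \<Longrightarrow> c \<noteq> d"
    and ex: "\<And>a b c. a \<in> pts u v \<Longrightarrow> b \<in> pts u v \<Longrightarrow> c \<in> pts u v \<Longrightarrow> distinct [a, b, c] \<Longrightarrow>
      \<exists>d\<in>pts u v. R a b c d"
    and uniq: "\<And>a b c d d'. R a b c d \<Longrightarrow> R a b c d' \<Longrightarrow> d \<in> pts u v \<Longrightarrow> d' \<in> pts u v \<Longrightarrow> d = d'"
  shows "SQS u v {{a, b, c, d} | a b c d. {a, b, c, d} \<subseteq> pts u v \<and> R a b c d}"
    (is "SQS u v ?S")
proof -
  have dist: "distinct [a, b, c, d]" if "R a b c d" for a b c d
  proof -
    have *: "R a c b d" "R b c a d" "R a d b c" "R b d a c" "R c d a b"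
      using swap that by blast+
    show ?thesis using *[THEN irrefl] irrefl[OF that] by auto
  qed
  define S where "S = ?S"
  have S_I: "{a, b, c, d} \<in> S" if "{a, b, c, d} \<subseteq> pts u v" "R a b c d" for a b c d
    using that unfolding S_def by blast
  have S_E: "\<exists>a b c d. B = {a, b, c, d} \<and> B \<subseteq> pts u v \<and> R a b c d" if "B \<in> S" for B
    using that unfolding S_def by blast
  have card_S: "finite B \<and> card B = 4" if B: "B \<in> S" for B
  proof -
    obtain a b c d where "B = {a, b, c, d}" "R a b c d" using S_E[OF B] by blast
    then show ?thesis using dist[of a b c d] by simp
  qed
  have "SQS u v S"
    unfolding SQS_def
  proof (intro conjI ballI allI impI)
    fix B assume "B \<in> S"
    then show "B \<subseteq> pts u v" "card B = 4" using S_E card_S by blast+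
  next
    fix T assume "T \<subseteq> pts u v \<and> card T = 3"
    then have T: "T \<subseteq> pts u v" "card T = 3" by simp_all
    obtain x y z where xyz: "T = {x, y, z}" "distinct [x, y, z]"
      using T(2) by (auto simp: card_3_iff)
    then obtain w where w: "w \<in> pts u v" "R x y z w"
      using ex[of x y z] T(1) by auto
    show "\<exists>!B. B \<in> S \<and> T \<subseteq> B"
    proof (rule ex1I)
      show "{x, y, z, w} \<in> S \<and> T \<subseteq> {x, y, z, w}" using S_I[of x y z w] w T(1) xyz(1) by auto
    next
      fix B assume "B \<in> S \<and> T \<subseteq> B"
      then have B: "B \<in> S" "T \<subseteq> B" by simp_all
      obtain a b c d where abcd: "B = {a, b, c, d}" "B \<subseteq> pts u v" "R a b c d" using S_E[OF B(1)] by blast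
      \<comment> \<open>A block through \<open>T\<close> has exactly one further point; total
        symmetry moves it to the last place, where \<open>uniq\<close> identifies it with
        \<open>w\<close>.\<close>
      have "card (B - T) = 1"
        using card_Diff_subset[of T B] B(2) T(2) card_S[OF B(1)] finite_subset[of T B] by simp
      then obtain w' where "B - T = {w'}" by (auto simp: card_1_singleton_iff)
      then have "B = insert w' T" "w' \<notin> T" using B(2) by blast+
      then have B': "B = {x, y, z, w'}" "distinct [x, y, z, w']"
        using xyz by (simp_all add: insert_commute, blast+)
      have "R x y z w'"
        by (rule totally_symmetric_quadruple[of R a b c d x y z w', OF swap abcd(3)]) (use abcd(1) B' in simp_all)
      moreover have "w' \<in> pts u v" using abcd(2) B'(1) by simp
      ultimately have "w' = w" using uniq[of x y z w' w] w by simp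
      then show "B = {x, y, z, w}" using B' by simp
    qed
  qed
  then show ?thesis unfolding S_def .
qed

text \<open>A set fixed by the shift by \<open>d\<close> contains the orbit of each of its points
  under multiples of \<open>d\<close>; as \<open>d\<close> is coprime to \<open>p\<close>, this
  orbit fills a whole row.\<close>

lemma shiftv_eq_imp_large:
  assumes "prime p" "0 < d" "d < p" "B \<noteq> {}" "finite B" "B \<subseteq> pts u p" "shiftv p d B = B"
  shows "p \<le> card B"
proof -
  obtain i x where ix: "(i, x) \<in> B" using assms(4) by auto
  have mem: "(i, (x + k * d) mod p) \<in> B" for k
  proof (induction k)
    case 0
    then show ?case using ix assms(6) by (auto simp: pts_def)
  next
    case (Suc k)
    then have "(i, ((x + k * d) mod p + d) mod p) \<in> shiftv p d B"
      unfolding shiftv_def by force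
    then show ?case using assms(7) by (simp add: mod_simps algebra_simps)
  qed
  have "inj_on (\<lambda>k. (i, (x + k * d) mod p)) {..<p}"
  proof (rule inj_onI)
    fix k l assume kl: "k \<in> {..<p}" "l \<in> {..<p}" "(i, (x + k * d) mod p) = (i, (x + l * d) mod p)"
    have "coprime d p" using assms(1-3) 
      by (metis coprime_commute nat_dvd_not_less prime_imp_coprime)
    moreover have "[x + k * d = x + l * d] (mod p)" using kl(3) by (simp add: cong_def)
    ultimately have "[k = l] (mod p)"
      by (metis cong_add_lcancel_nat cong_mult_rcancel_nat)
    then show "k = l" using kl(1,2) by (simp add: cong_less_modulus_unique_nat)
  qed
  then have "card {..<p} \<le> card B"
    using card_inj_on_le[of _ "{..<p}" B] mem assms(5) by blast
  then show ?thesis by simp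
qed

section \<open>Codes from strictly cyclic quadruple systems\<close>

lemma shiftv_shiftv: "shiftv v d (shiftv v e B) = shiftv v (e + d) B"
  unfolding shiftv_def image_image by (rule image_cong) (auto simp: mod_simps add.assoc)

lemma shiftv_mod: "shiftv v (d mod v) B = shiftv v d B"
  unfolding shiftv_def by (rule image_cong) (auto simp: mod_simps)

lemma shiftv_0: "B \<subseteq> pts u v \<Longrightarrow> shiftv v 0 B = B"
  unfolding shiftv_def pts_def by (force simp: image_iff)

lemma inj_on_shift:
  "inj_on (\<lambda>(i :: nat, x :: nat). (i, (x + d) mod v)) (pts u v)"
proof (rule inj_onI)
  fix P Q :: "nat \<times> nat"
  assume *: "P \<in> pts u v" "Q \<in> pts u v"
    "(\<lambda>(i, x). (i, (x + d) mod v)) P = (\<lambda>(i, x). (i, (x + d) mod v)) Q"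
  then have "[snd P + d = snd Q + d] (mod v)" "fst P = fst Q"
    by (auto simp: cong_def split: prod.splits)
  then have "[snd P = snd Q] (mod v)" by (simp add: cong_add_rcancel_nat)
  moreover have "snd P < v" "snd Q < v" using *(1,2) by (auto simp: pts_def)
  ultimately show "P = Q"
    using \<open>fst P = fst Q\<close> by (simp add: cong_less_modulus_unique_nat prod_eq_iff)
qed

lemma card_shiftv: "B \<subseteq> pts u v \<Longrightarrow> card (shiftv v d B) = card B"
  unfolding shiftv_def by (intro card_image inj_on_subset[OF inj_on_shift])

lemma choose_3: "6 * (n choose 3) = n * (n - 1) * (n - 2)"
proof -
  have "3 * (n choose 3) = n * ((n - 1) choose 2)"
    using times_binomial_minus1_eq[of 3 n] by simp
  moreover have "2 * ((n - 1) choose 2) = (n - 1) * (n - 2)"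
    using times_binomial_minus1_eq[of 2 "n - 1"] by (simp add: numeral_2_eq_2)
  moreover have "6 * (n choose 3) = 2 * (3 * (n choose 3))" by simp
  ultimately show ?thesis by (metis mult.assoc mult.left_commute)
qed

text \<open>Double counting of incident pairs of a block and a triple: each block has four triples,
  and the projection to the triple is bijective by the Steiner property.\<close>

lemma SQS_card:
  assumes "SQS u v S"
  shows "finite S" "4 * card S = (u * v) choose 3"
proof -
  have S: "B \<subseteq> pts u v" "card B = 4" if "B \<in> S" for B using assms that unfolding SQS_def by auto
  have ex1: "\<exists>!B. B \<in> S \<and> T \<subseteq> B" if "T \<subseteq> pts u v" "card T = 3" for T
    using assms that unfolding SQS_def by auto
  have fin: "finite (pts u v)" "card (pts u v) = u * v" by (auto simp: pts_def)
  show "finite S" by (rule finite_subset[of _ "Pow (pts u v)"]) (use S fin in auto)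
  define I where "I = (SIGMA B:S. {T. T \<subseteq> B \<and> card T = 3})"
  have finB: "finite B" if "B \<in> S" for B using S[OF that] by (intro card_ge_0_finite) simp
  have "card I = (\<Sum>B\<in>S. card {T. T \<subseteq> B \<and> card T = 3})"
    unfolding I_def using finB by (intro card_SigmaI) (auto simp: \<open>finite S\<close>)
  also have "\<dots> = (\<Sum>B\<in>S. 4)"
  proof (rule sum.cong[OF refl])
    fix B assume "B \<in> S"
    then show "card {T. T \<subseteq> B \<and> card T = 3} = 4"
      using n_subsets[OF finB, of B 3] S(2)[of B] by (simp add: eval_nat_numeral)
  qed
  finally have "card I = 4 * card S" by simp
  moreover have "bij_betw snd I {T. T \<subseteq> pts u v \<and> card T = 3}"
    unfolding bij_betw_def
  proof
    show "inj_on snd I"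
    proof (rule inj_onI)
      fix P Q assume "P \<in> I" "Q \<in> I" "snd P = snd Q"
      then show "P = Q"
        using ex1[of "snd P"] S unfolding I_def by (cases P; cases Q; simp) (metis subset_trans)
    qed
    show "snd ` I = {T. T \<subseteq> pts u v \<and> card T = 3}"
    proof (intro equalityI subsetI)
      fix T assume "T \<in> snd ` I" then show "T \<in> {T. T \<subseteq> pts u v \<and> card T = 3}"
        using S(1) unfolding I_def by fastforce
    next
      fix T assume "T \<in> {T. T \<subseteq> pts u v \<and> card T = 3}"
      then obtain B where "B \<in> S" "T \<subseteq> B" "card T = 3" using ex1[of T] by auto
      then show "T \<in> snd ` I" unfolding I_def by force
    qed
  qed
  ultimately show "4 * card S = (u * v) choose 3"
    using n_subsets[OF fin(1), of 3] fin(2) bij_betw_same_card[of snd I] by simp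
qed

text \<open>One block is chosen from each translation orbit. Strictness makes every orbit have
  length \<open>v\<close>, which gives the size of the code; three coincidences between shifted
  codewords would put a triple into two blocks.\<close>

lemma perfect_OOC2D_of_strictly_cyclic_SQS:
  assumes "strictly_cyclic_SQS u v S" "0 < v"
  shows "\<exists>C. perfect_OOC2D u v C"
proof -
  have SQS: "SQS u v S" and shift1: "\<And>B. B \<in> S \<Longrightarrow> shiftv v 1 B \<in> S"
    and strict: "\<And>B d. B \<in> S \<Longrightarrow> 0 < d \<Longrightarrow> d < v \<Longrightarrow> shiftv v d B \<noteq> B"
    using assms(1) unfolding strictly_cyclic_SQS_def by auto
  have S: "B \<subseteq> pts u v" "card B = 4" if "B \<in> S" for B using SQS that unfolding SQS_def by auto
  have uniq: "B = B'" if "B \<in> S" "B' \<in> S" "T \<subseteq> B" "T \<subseteq> B'" "card T = 3" for B B' T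
    using SQS that S unfolding SQS_def by (metis (no_types, lifting) subset_trans)
  have shift: "shiftv v d B \<in> S" if "B \<in> S" for d B
  proof (induction d)
    case 0 then show ?case using that S shiftv_0 by metis
  next
    case (Suc d) then show ?case using shift1[OF Suc] by (simp add: shiftv_shiftv)
  qed
  \<comment> \<open>\<open>v - d mod v\<close> serves as the negative of \<open>d\<close> in the
    naturals. It equals \<open>v\<close>, not \<open>0\<close>, when \<open>v\<close> divides
    \<open>d\<close>; where an index below \<open>v\<close> is needed, a further
    \<open>mod v\<close> is applied.\<close>
  have unshift: "shiftv v (v - d mod v) (shiftv v d B) = B" if "B \<in> S" for d B
  proof -
    have "(d + (v - d mod v)) mod v = (d mod v + (v - d mod v)) mod v" by (simp add: mod_simps)
    also have "\<dots> = 0" using assms(2) by (simp add: less_imp_le)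
    finally have "shiftv v (d + (v - d mod v)) B = shiftv v 0 B" by (metis shiftv_mod)
    then show ?thesis using shiftv_0 S(1)[OF that] by (simp add: shiftv_shiftv)
  qed
  define E where "E = (\<lambda>A B. B \<in> S \<and> (\<exists>d. B = shiftv v d A))"
  define f where "f = (\<lambda>A. SOME B. E A B)"
  define C where "C = f ` S"
  have E_shift: "E A (shiftv v d A)" if "A \<in> S" for A d unfolding E_def using that shift by blast
  have E_f: "E A (f A)" if "A \<in> S" for A
    unfolding f_def using E_shift[OF that] by (rule someI)
  \<comment> \<open>Blocks of one orbit have the same predicate \<open>E\<close>, so the choice
    operator returns the same representative for both.\<close>
  have f_eq: "f A = f B" if "A \<in> S" "E A B" for A B
  proof -
    have "E A D \<longleftrightarrow> E B D" for D
      using that unshift unfolding E_def by (metis shiftv_shiftv)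
    then show ?thesis unfolding f_def by presburger
  qed
  have C_S: "C \<subseteq> S" using E_f unfolding C_def E_def by auto
  have f_id: "f A = A" if "A \<in> C" for A
    using that E_f f_eq unfolding C_def by auto
  have rep: "A = B" if "A \<in> C" "B \<in> C" "B = shiftv v d A" for A B d
    using f_eq[of A B] f_id that C_S E_shift by (metis subsetD)
  have bij: "bij_betw (\<lambda>(A, d). shiftv v d A) (C \<times> {..<v}) S"
    unfolding bij_betw_def
  proof
    show "inj_on (\<lambda>(A, d). shiftv v d A) (C \<times> {..<v})"
    proof (rule inj_onI, clarify)
      fix A d B e assume *: "A \<in> C" "d < v" "B \<in> C" "e < v" "shiftv v d A = shiftv v e B"
      have "B = shiftv v (d + (v - e mod v)) A"
        using unshift[of B e] *(3,5) C_S shiftv_shiftv[of v "v - e mod v" d A] by auto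
      then have AB: "A = B" using rep *(1,3) by blast
      \<comment> \<open>Shifting both sides back by \<open>d\<close> leaves \<open>A\<close> fixed
        by the nonzero shift \<open>e - d\<close>, against strictness.\<close>
      moreover have False if "d < e" "shiftv v d A = shiftv v e A" "e < v" "A \<in> S" for d e
      proof -
        have "shiftv v (d + (v - d mod v)) A = shiftv v (e + (v - d mod v)) A"
          using that(2) by (metis shiftv_shiftv)
        moreover have "e + (v - d mod v) = (e - d) + v" using that(1,3) by simp
        then have "(e + (v - d mod v)) mod v = e - d" using that(3) by simp
        ultimately have "shiftv v (e - d) A = A"
          using unshift[OF that(4), of d] shiftv_shiftv shiftv_mod by metis
        then show False using strict[OF that(4), of "e - d"] that(1,3) by simp
      qed
      ultimately show "A = B \<and> d = e" using * C_S by (metis linorder_neqE_nat subsetD)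
    qed
    show "(\<lambda>(A, d). shiftv v d A) ` (C \<times> {..<v}) = S"
    proof (intro equalityI subsetI)
      fix B assume "B \<in> (\<lambda>(A, d). shiftv v d A) ` (C \<times> {..<v})"
      then show "B \<in> S" using shift C_S by auto
    next
      fix B assume B: "B \<in> S"
      then obtain d where "f B = shiftv v d B" using E_f unfolding E_def by blast
      then have "B = shiftv v ((v - d mod v) mod v) (f B)" using unshift[OF B, of d] by (simp add: shiftv_mod)
      moreover have "f B \<in> C" using B unfolding C_def by simp
      ultimately show "B \<in> (\<lambda>(A, d). shiftv v d A) ` (C \<times> {..<v})"
        using assms(2) by (force intro!: image_eqI[of _ _ "(f B, (v - d mod v) mod v)"])
    qed
  qed
  have "card C * v = card S" using bij_betw_same_card[OF bij] by (simp add: card_cartesian_product)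
  then have "24 * (card C * v) = 6 * ((u * v) choose 3)" using SQS_card(2)[OF SQS] by simp
  also have "\<dots> = u * (u * v - 1) * (u * v - 2) * v" unfolding choose_3 by simp
  finally have "24 * card C = u * (u * v - 1) * (u * v - 2)"
    using assms(2) by (metis mult.assoc mult_right_cancel neq0_conv)
  then have card_C: "card C = u * (u * v - 1) * (u * v - 2) div 24" by simp
  have "corr v A B r \<le> 2" if AB: "A \<in> C" "B \<in> C" "A \<noteq> B \<or> r mod int v \<noteq> 0" for A B r
  proof (rule ccontr)
    define d where "d = nat (r mod int v)"
    define X where "X = {(i, j). (i, j) \<in> A \<and> (i, nat ((int j + r) mod int v)) \<in> B}"
    have d: "int d = r mod int v" "d < v" using assms(2) by (auto simp: d_def nat_less_iff)
    have "nat ((int j + r) mod int v) = (j + d) mod v" for j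
    proof -
      have "(int j + r) mod int v = int ((j + d) mod v)"
        using d(1) by (simp add: zmod_int mod_simps)
      then show ?thesis by simp
    qed
    then have X_B: "shiftv v d X \<subseteq> B" unfolding X_def shiftv_def by auto
    assume "\<not> corr v A B r \<le> 2"
    then have "3 \<le> card X" unfolding corr_def X_def by simp
    then obtain T where T: "T \<subseteq> X" "card T = 3" by (meson obtain_subset_with_card_n)
    have "X \<subseteq> A" unfolding X_def by auto
    then have TA: "T \<subseteq> A" "T \<subseteq> pts u v" using T(1) AB(1) C_S S by blast+
    have "shiftv v d T \<subseteq> B" "shiftv v d T \<subseteq> shiftv v d A"
      using X_B T(1) TA(1) unfolding shiftv_def by blast+
    \<comment> \<open>The triple \<open>shiftv v d T\<close> lies in both blocks. Two
      representatives of one orbit coincide, so \<open>A = B\<close>, and then \<open>d\<close> must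
      be nonzero and would fix \<open>A\<close>.\<close>
    then have "B = shiftv v d A"
      using uniq[of B "shiftv v d A" "shiftv v d T"] AB C_S shift card_shiftv[OF TA(2)] T(2)
      by (metis subsetD)
    moreover from this have "A = B" using rep AB(1,2) by blast
    ultimately show False using strict[of A d] AB d C_S by (metis gr0I of_nat_0 subsetD)
  qed
  then have "OOC2D u v C" using C_S S unfolding OOC2D_def by blast
  then show ?thesis using card_C unfolding perfect_OOC2D_def by blast
qed

section \<open>Two rows with opposite blocks\<close>

text \<open>\<open>pure_ex\<close> and \<open>K_D\<close> say that three points of one row are
  completed by exactly one of \<open>K\<close> and \<open>D\<close>; \<open>mixed_ex\<close> and
  \<open>M_D\<close> say the same of \<open>D\<close> and \<open>M\<close> for two points of a row
  and one of the other. Since row 1 carries negatives, a block with two points in each row can be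
  read from either row; \<open>M_minus\<close> makes both readings agree. Congruence and
  irreflexivity are assumed in few places, as the symmetries carry them to the others.\<close>

locale doubling =
  fixes p :: nat
    and K D M :: "int \<Rightarrow> int \<Rightarrow> int \<Rightarrow> int \<Rightarrow> bool"
  assumes prime_p: "prime p" and p_gt_4: "4 < p"
    and K_swap: "K x y z w \<Longrightarrow> K y x z w" "K x y z w \<Longrightarrow> K x z y w" "K x y z w \<Longrightarrow> K x y w z"
    and D_swap: "D x y z w \<Longrightarrow> D y x z w" "D x y z w \<Longrightarrow> D x z y w"
    and M_swap: "M x y c d \<Longrightarrow> M y x c d" "M x y c d \<Longrightarrow> M x y d c"
    and M_minus: "M x y c d \<Longrightarrow> M (- c) (- d) (- x) (- y)"
    and K_add: "K x y z w \<Longrightarrow> K (x + t) (y + t) (z + t) (w + t)"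
    and D_add: "D x y z w \<Longrightarrow> D (x + t) (y + t) (z + t) (w + t)"
    and M_add: "M x y c d \<Longrightarrow> M (x + t) (y + t) (c + t) (d + t)"
    and K_cong: "K x y z w \<Longrightarrow> [w = w'] (mod int p) \<Longrightarrow> K x y z w'"
    and D_cong: "D x y z w \<Longrightarrow> [w = w'] (mod int p) \<Longrightarrow> D x y z w'"
      "D x y z w \<Longrightarrow> [z = z'] (mod int p) \<Longrightarrow> D x y z' w"
    and M_cong: "M x y c d \<Longrightarrow> [d = d'] (mod int p) \<Longrightarrow> M x y c d'"
    and K_irrefl: "K x y z w \<Longrightarrow> [z \<noteq> w] (mod int p)"
    and D_irrefl: "D x y z w \<Longrightarrow> [y \<noteq> z] (mod int p)"
    and M_irrefl: "M x y c d \<Longrightarrow> [c \<noteq> d] (mod int p)"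
    and pure_ex: "[x \<noteq> y] (mod int p) \<Longrightarrow> [x \<noteq> z] (mod int p) \<Longrightarrow> [y \<noteq> z] (mod int p) \<Longrightarrow>
      (\<exists>w. K x y z w) \<or> (\<exists>w. D x y z w)"
    and K_D: "K x y z w \<Longrightarrow> \<not> D x y z w'"
    and K_unique: "K x y z w \<Longrightarrow> K x y z w' \<Longrightarrow> [w = w'] (mod int p)"
    and D_unique: "D x y z w \<Longrightarrow> D x y z w' \<Longrightarrow> [w = w'] (mod int p)"
    and mixed_ex: "[x \<noteq> y] (mod int p) \<Longrightarrow> (\<exists>z. D x y z c) \<or> (\<exists>d. M x y c d)"
    and M_D: "M x y c d \<Longrightarrow> \<not> D x y z c"
    and M_unique: "M x y c d \<Longrightarrow> M x y c d' \<Longrightarrow> [d = d'] (mod int p)"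
    and D_unique': "D x y z c \<Longrightarrow> D x y z' c \<Longrightarrow> [z = z'] (mod int p)"
begin

text \<open>The flags tell which points lie in row 1; row 1 carries the negatives of the blocks of row 0.\<close>

fun blk :: "bool \<Rightarrow> bool \<Rightarrow> bool \<Rightarrow> bool \<Rightarrow> int \<Rightarrow> int \<Rightarrow> int \<Rightarrow> int \<Rightarrow> bool" where
  "blk False False False False x y z w = K x y z w"
| "blk False False False True x y z w = D x y z w"
| "blk False False True False x y z w = D x y w z"
| "blk False True False False x y z w = D x z w y"
| "blk True False False False x y z w = D y z w x"
| "blk False False True True x y z w = M x y z w"
| "blk False True False True x y z w = M x z y w"
| "blk False True True False x y z w = M x w y z"
| "blk True False False True x y z w = M y z x w"
| "blk True False True False x y z w = M y w x z"
| "blk True True False False x y z w = M z w x y"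
| "blk True True True False x y z w = D (- x) (- y) (- z) (- w)"
| "blk True True False True x y z w = D (- x) (- y) (- w) (- z)"
| "blk True False True True x y z w = D (- x) (- z) (- w) (- y)"
| "blk False True True True x y z w = D (- y) (- z) (- w) (- x)"
| "blk True True True True x y z w = K (- x) (- y) (- z) (- w)"

lemma M_minus': "M (- c) (- d) (- x) (- y) \<longleftrightarrow> M x y c d"
  using M_minus[of x y c d] M_minus[of "- c" "- d" "- x" "- y"] by auto

lemma blk_swap:
  "blk i j k l x y z w \<Longrightarrow> blk j i k l y x z w"
  "blk i j k l x y z w \<Longrightarrow> blk i k j l x z y w"
  "blk i j k l x y z w \<Longrightarrow> blk i j l k x y w z"
  by (cases i; cases j; cases k; cases l; simp; erule K_swap D_swap M_swap)+

lemma D_add_minus: "D (- x) (- y) (- z) (- w) \<Longrightarrow> D (- x - t) (- y - t) (- z - t) (- w - t)"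
  using D_add[of "- x" "- y" "- z" "- w" "- t"] by simp

lemma K_add_minus: "K (- x) (- y) (- z) (- w) \<Longrightarrow> K (- x - t) (- y - t) (- z - t) (- w - t)"
  using K_add[of "- x" "- y" "- z" "- w" "- t"] by simp

lemma blk_add: "blk i j k l x y z w \<Longrightarrow> blk i j k l (x + t) (y + t) (z + t) (w + t)"
  using K_add D_add M_add K_add_minus D_add_minus
  by (cases i; cases j; cases k; cases l; simp)

text \<open>When the last point lies in row 0 and two others in row 1, it sits in the first half of
  \<open>M\<close>; \<open>M_minus\<close> carries it to the place that \<open>M_cong\<close>
  handles.\<close>

lemma blk_cong4:
  assumes "blk i j k l x y z w" "[w = w'] (mod int p)"
  shows "blk i j k l x y z w'"
proof -
  have m: "[- w = - w'] (mod int p)" using assms(2) by (simp add: cong_minus_minus_iff)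
  have M': "M x w' c d" if "M x w c d" for x c d
    using M_cong[OF M_minus[OF that] m] by (simp only: M_minus')
  show ?thesis
    using assms(1) K_cong[OF _ assms(2)] K_cong[OF _ m] D_cong[OF _ assms(2)] D_cong[OF _ m]
      M_cong[OF _ assms(2)] M'
    by (cases i; cases j; cases k; cases l; simp)
qed

lemma blk_cong:
  assumes "blk i j k l x y z w" "[x = x'] (mod int p)" "[y = y'] (mod int p)"
    "[z = z'] (mod int p)" "[w = w'] (mod int p)"
  shows "blk i j k l x' y' z' w'"
proof -
  have 3: "blk i j k l x y z' w" if "blk i j k l x y z w" "[z = z'] (mod int p)" for i j k l x y z z' w
    by (rule blk_swap(3)[OF blk_cong4[OF blk_swap(3)[OF that(1)] that(2)]])
  have 2: "blk i j k l x y' z w" if "blk i j k l x y z w" "[y = y'] (mod int p)" for i j k l x y y' z w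
    by (rule blk_swap(2)[OF 3[OF blk_swap(2)[OF that(1)] that(2)]])
  have 1: "blk i j k l x' y z w" if "blk i j k l x y z w" "[x = x'] (mod int p)" for i j k l x x' y z w
    by (rule blk_swap(1)[OF 2[OF blk_swap(1)[OF that(1)] that(2)]])
  show ?thesis by (rule 1[OF 2[OF 3[OF blk_cong4]]]) fact+
qed

text \<open>The restriction \<open>k = l\<close> is essential: points of different rows may share
  their second coordinate.\<close>

lemma blk_irrefl:
  assumes "blk i j k l x y z w" "k = l"
  shows "[z \<noteq> w] (mod int p)"
  using assms K_irrefl[of x y z w] D_irrefl[of x z w y] D_irrefl[of y z w x] K_irrefl[of "- x" "- y" "- z" "- w"]
    M_irrefl[of x y z w] D_irrefl[of "- x" "- z" "- w" "- y"] D_irrefl[of "- y" "- z" "- w" "- x"]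
    M_minus[of z w x y] M_irrefl[of "- x" "- y" "- z" "- w"]
  by (cases i; cases j; cases k; cases l; simp add: cong_minus_minus_iff)

lemma blk_ex:
  assumes "i = j \<Longrightarrow> [x \<noteq> y] (mod int p)" "i = k \<Longrightarrow> [x \<noteq> z] (mod int p)" "j = k \<Longrightarrow> [y \<noteq> z] (mod int p)"
  shows "\<exists>l w. blk i j k l x y z w"
proof -
  have mixed: "(\<exists>z. D (- x) (- y) (- z) (- c)) \<or> (\<exists>d. M c d x y)" if "[x \<noteq> y] (mod int p)" for x y c
    using mixed_ex[of "- x" "- y" "- c"] that M_minus'[of _ _ c] 
    by (metis cong_minus_minus_iff minus_minus)
  have pure: "(\<exists>w. K (- x) (- y) (- z) (- w)) \<or> (\<exists>w. D (- x) (- y) (- z) (- w))"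
    if "[x \<noteq> y] (mod int p)" "[x \<noteq> z] (mod int p)" "[y \<noteq> z] (mod int p)"
    using pure_ex[of "- x" "- y" "- z"] that by (metis cong_minus_minus_iff minus_minus)
  show ?thesis
  proof (rule ccontr)
    assume "\<not> ?thesis"
    then have "\<not> blk i j k False x y z w" "\<not> blk i j k True x y z w" for w by auto
    then show False
      using assms pure_ex[of x y z] pure mixed_ex[of x y z] mixed_ex[of x z y] mixed_ex[of y z x]
        mixed[of x y z] mixed[of x z y] mixed[of y z x]
      by (cases i; cases j; cases k; simp; blast?)
  qed
qed

text \<open>The three flags decide which relations can complete the triple. Exclusiveness of the
  relations (\<open>K_D\<close>, \<open>M_D\<close>) fixes the row of the fourth point, and the
  uniqueness assumptions fix its residue; negation transfers this to row 1.\<close>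

lemma blk_unique:
  assumes "blk i j k l x y z w" "blk i j k l' x y z w'"
  shows "l = l' \<and> [w = w'] (mod int p)"
proof -
  have M_unique': "[w = w'] (mod int p)" if "M x w c d" "M x w' c d" for x w w' c d
    using M_unique[of "- c" "- d" "- x" "- w" "- w'"] that M_minus by (metis cong_minus_minus_iff)
  have M_D': "\<not> D (- c) (- d) z (- x)" if "M x y c d" for x y c d z
    using M_D[of "- c" "- d" "- x" "- y"] M_minus[of x y c d] that by blast
  consider i j k | i j "\<not> k" | i "\<not> j" k | i "\<not> j" "\<not> k"
    | "\<not> i" j k | "\<not> i" j "\<not> k" | "\<not> i" "\<not> j" k | "\<not> i" "\<not> j" "\<not> k"
    by blast
  then show ?thesis
  proof cases
    case 1
    then show ?thesis
      using assms K_D[of "- x" "- y" "- z"] K_unique[of "- x" "- y" "- z" "- w" "- w'"]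
        D_unique[of "- x" "- y" "- z" "- w" "- w'"]
      by (cases l; cases l'; auto simp: cong_minus_minus_iff)
  next
    case 2
    then show ?thesis
      using assms M_D'[of z _ x y] M_unique'[of z w x y w'] D_unique'[of "- x" "- y" "- w" "- z" "- w'"]
      by (cases l; cases l'; auto simp: cong_minus_minus_iff)
  next
    case 3
    then show ?thesis
      using assms M_D'[of y _ x z] M_unique'[of y w x z w'] D_unique'[of "- x" "- z" "- w" "- y" "- w'"]
      by (cases l; cases l'; auto simp: cong_minus_minus_iff)
  next
    case 4
    then show ?thesis
      using assms M_D[of y z x] M_unique[of y z x w w'] D_unique'[of y z w x w']
      by (cases l; cases l'; auto simp: cong_minus_minus_iff)
  next
    case 5
    then show ?thesis
      using assms M_D'[of x _ y z] M_unique'[of x w y z w'] D_unique'[of "- y" "- z" "- w" "- x" "- w'"]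
      by (cases l; cases l'; auto simp: cong_minus_minus_iff)
  next
    case 6
    then show ?thesis
      using assms M_D[of x z y] M_unique[of x z y w w'] D_unique'[of x z w y w']
      by (cases l; cases l'; auto simp: cong_minus_minus_iff)
  next
    case 7
    then show ?thesis
      using assms M_D[of x y z] M_unique[of x y z w w'] D_unique'[of x y w z w']
      by (cases l; cases l'; auto simp: cong_minus_minus_iff)
  next
    case 8
    then show ?thesis
      using assms K_D[of x y z] K_unique[of x y z w w'] D_unique[of x y z w w']
      by (cases l; cases l'; auto simp: cong_minus_minus_iff)
  qed
qed

text \<open>Every row number other than 1 is read as row 0, so \<open>R\<close> is meaningful only
  on \<open>pts 2 p\<close>, to which \<open>blocks\<close> restricts it.\<close>

definition R :: "nat \<times> nat \<Rightarrow> nat \<times> nat \<Rightarrow> nat \<times> nat \<Rightarrow> nat \<times> nat \<Rightarrow> bool" where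
  "R a b c d \<longleftrightarrow> blk (fst a = 1) (fst b = 1) (fst c = 1) (fst d = 1)
     (int (snd a)) (int (snd b)) (int (snd c)) (int (snd d))"

lemma cong_pts_imp_eq:
  assumes "a \<in> pts 2 p" "b \<in> pts 2 p" "(fst a = 1) = (fst b = 1)" "[int (snd a) = int (snd b)] (mod int p)"
  shows "a = b"
  using assms by (auto simp: pts_def cong_int_iff cong_less_modulus_unique_nat less_2_cases_iff)

definition blocks :: "(nat \<times> nat) set set" where
  "blocks = {{a, b, c, d} | a b c d. {a, b, c, d} \<subseteq> pts 2 p \<and> R a b c d}"

lemma SQS_blocks: "SQS 2 p blocks"
  unfolding blocks_def
proof (rule SQS_of_relation)
  fix a b c d assume "R a b c d"
  then show "R b a c d" "R a c b d" "R a b d c" unfolding R_def by (fact blk_swap)+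
  show "c \<noteq> d"
  proof
    assume "c = d"
    then show False using blk_irrefl[OF \<open>R a b c d\<close>[unfolded R_def]] by simp
  qed
next
  fix a b c assume abc: "a \<in> pts 2 p" "b \<in> pts 2 p" "c \<in> pts 2 p" "distinct [a, b, c]"
  then obtain l w where lw: "blk (fst a = 1) (fst b = 1) (fst c = 1) l (int (snd a)) (int (snd b)) (int (snd c)) w"
    using blk_ex[of "fst a = 1" "fst b = 1" "int (snd a)" "int (snd b)" "fst c = 1" "int (snd c)"]
      cong_pts_imp_eq by (metis distinct_length_2_or_more)
  define d where "d = (if l then 1 else 0 :: nat, nat (w mod int p))"
  have "R a b c d"
    using blk_cong4[OF lw, of "w mod int p"] p_gt_4 unfolding R_def d_def by (cases l) auto
  moreover have "d \<in> pts 2 p"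
    using p_gt_4 by (auto simp: d_def pts_def nat_less_iff)
  ultimately show "\<exists>d\<in>pts 2 p. R a b c d" by blast
next
  fix a b c d d' assume "R a b c d" "R a b c d'" "d \<in> pts 2 p" "d' \<in> pts 2 p"
  then show "d = d'" using blk_unique cong_pts_imp_eq unfolding R_def by meson
qed

lemma strictly_cyclic_blocks: "strictly_cyclic_SQS 2 p blocks"
  unfolding strictly_cyclic_SQS_def
proof (intro conjI ballI allI impI)
  show "SQS 2 p blocks" by (fact SQS_blocks)
next
  fix B assume "B \<in> blocks"
  then obtain a b c d where B: "B = {a, b, c, d}" "B \<subseteq> pts 2 p" "R a b c d"
    unfolding blocks_def by blast
  define s where "s = (\<lambda>(i :: nat, x). (i, (x + 1) mod p))"
  have "[int (snd e) + 1 = int (snd (s e))] (mod int p)" for e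
    by (cases e) (simp add: s_def zmod_int cong_def mod_simps add.commute)
  moreover have "fst (s e) = fst e" for e by (cases e) (simp add: s_def)
  ultimately have "R (s a) (s b) (s c) (s d)"
    using blk_cong[OF blk_add[OF B(3)[unfolded R_def], of 1]] unfolding R_def by presburger
  moreover have "shiftv p 1 B = {s a, s b, s c, s d}" unfolding shiftv_def s_def B(1) by simp
  moreover have "s e \<in> pts 2 p" if "e \<in> pts 2 p" for e
    using that p_gt_4 by (cases e) (simp add: pts_def s_def)
  ultimately show "shiftv p 1 B \<in> blocks"
    using B unfolding blocks_def by blast
next
  fix B d assume B: "B \<in> blocks" "0 < d \<and> d < p"
  then have "B \<subseteq> pts 2 p" "card B = 4" using SQS_blocks unfolding SQS_def by blast+
  then show "shiftv p d B \<noteq> B"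
    using shiftv_eq_imp_large[OF prime_p, of d B 2] B(2) p_gt_4
    by (metis card.empty card.infinite not_less zero_neq_numeral)
qed

end

section \<open>Primes congruent to 7 modulo 12\<close>

text \<open>For a primitive root \<open>g\<close>, the power \<open>w\<close> of exponent
  \<open>(p - 1) div 3\<close> is a primitive cube root of unity, and \<open>- w\<close> is the
  required sixth root.\<close>

lemma primitive_sixth_root_exists:
  fixes p :: nat
  assumes "prime p" "p mod 3 = 1"
  shows "\<exists>e::int. int p dvd e\<^sup>2 - e + 1"
proof -
  have "2 < p" using assms prime_ge_2_nat[of p] by (cases "p = 2") auto
  then obtain g where g: "residue_primroot p g"
    using residue_primroot_odd_prime_power_exists[of p] assms(1)
    by (metis One_nat_def power_one_right prime_odd_nat zero_less_one)
  define n where "n = (p - 1) div 3"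
  have n: "p - 1 = 3 * n" "0 < n" using assms(2) \<open>2 < p\<close> unfolding n_def by presburger+
  have ord: "ord p g = p - 1"
    using g assms(1) by (simp add: residue_primroot_def totient_prime)
  define w where "w = int g ^ n"
  have "[g ^ (p - 1) = 1] (mod p)" by (simp add: ord_divides' ord)
  then have "[int (g ^ (p - 1)) = int 1] (mod int p)" by (simp only: cong_int_iff)
  then have "int p dvd w ^ 3 - 1"
    unfolding n(1) by (simp add: w_def power_mult mult.commute[of 3] cong_iff_dvd_diff)
  then have "int p dvd (w - 1) * (w\<^sup>2 + w + 1)"
    by (simp add: algebra_simps power2_eq_square power3_eq_cube)
  moreover have "\<not> int p dvd w - 1"
  proof
    assume "int p dvd w - 1"
    then have "[int (g ^ n) = int 1] (mod int p)" by (simp add: w_def cong_iff_dvd_diff)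
    then have "[g ^ n = 1] (mod p)" by (simp only: cong_int_iff)
    then have "p - 1 dvd n" by (simp add: ord_divides' ord)
    then show False using n by (auto dest: dvd_imp_le)
  qed
  ultimately have "int p dvd w\<^sup>2 + w + 1"
    using assms(1) by (simp add: prime_dvd_mult_iff)
  then show ?thesis by (intro exI[of _ "- w"]) simp
qed

section \<open>Arithmetic modulo a prime, with congruences as divisibility by \<open>P\<close> to
  suit Groebner basis reasoning\<close>

locale prime_modulus =
  fixes p :: nat and P :: int
  assumes prime_p: "prime p" and P_def: "P = int p"
begin

lemma prime_P: "prime P" using prime_p P_def by simp

lemma dvd_mult_P: "P dvd a * b \<longleftrightarrow> P dvd a \<or> P dvd b"
  using prime_P by (simp add: prime_dvd_mult_iff)

lemma ex_div: "\<not> P dvd a \<Longrightarrow> \<exists>t. P dvd a * t - b"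
proof -
  assume "\<not> P dvd a"
  then have "coprime a P" using prime_P by (metis coprime_commute prime_imp_coprime)
  then obtain t where "[a * t = 1] (mod P)" using cong_solve_coprime_int by blast
  then have "P dvd a * (t * b) - b" unfolding cong_iff_dvd_diff by Groebner_Basis.algebra
  then show ?thesis by blast
qed

end

locale equianharmonic = prime_modulus +
  fixes e :: int
  assumes p_mod: "p mod 12 = 7" and e: "P dvd e\<^sup>2 - e + 1"
begin

text \<open>Euler's criterion: these are the nonzero squares modulo \<open>P\<close>.\<close>

definition Q :: "int \<Rightarrow> bool" where "Q a \<longleftrightarrow> P dvd a ^ ((p - 1) div 2) - 1"

text \<open>The quadratic character of the Vandermonde product serves as an orientation: cyclic
  rotations keep the product and transpositions negate it.\<close>

definition pos :: "int \<Rightarrow> int \<Rightarrow> int \<Rightarrow> bool" where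
  "pos x y z \<longleftrightarrow> Q ((x - y) * (y - z) * (z - x))"

text \<open>The cross ratio condition \<open>(x - z) (y - w) / ((y - z) (x - w)) = e\<close>,
  cleared of denominators.\<close>

definition eqh :: "int \<Rightarrow> int \<Rightarrow> int \<Rightarrow> int \<Rightarrow> bool" where
  "eqh x y z w \<longleftrightarrow> P dvd (x - z) * (y - w) - e * (y - z) * (x - w)"

text \<open>The limit of \<open>eqh\<close> when the fourth point goes to infinity.\<close>

definition eql :: "int \<Rightarrow> int \<Rightarrow> int \<Rightarrow> bool" where
  "eql x y z \<longleftrightarrow> P dvd (x - z) - e * (y - z)"

definition K :: "int \<Rightarrow> int \<Rightarrow> int \<Rightarrow> int \<Rightarrow> bool" where
  "K x y z w \<longleftrightarrow> pos x y z \<and> eqh x y z w \<or> pos y x z \<and> eqh y x z w"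

definition D :: "int \<Rightarrow> int \<Rightarrow> int \<Rightarrow> int \<Rightarrow> bool" where
  "D x y z w \<longleftrightarrow> P dvd 3 * w - (x + y + z) \<and> (pos x y z \<and> eql x y z \<or> pos y x z \<and> eql y x z)"

text \<open>The indices \<open>j\<close> and \<open>j + 1\<close> with \<open>j\<close> odd run
  through the pairs 1, 2 up to \<open>P - 2\<close>, \<open>P - 1\<close>; index 0, the centre, is
  left to \<open>D\<close>.\<close>

definition M :: "int \<Rightarrow> int \<Rightarrow> int \<Rightarrow> int \<Rightarrow> bool" where
  "M x y c d \<longleftrightarrow> (\<exists>z w j. D x y z w \<and> odd j \<and> 0 < j \<and> j < P - 1 \<and>
     (P dvd c - (w + j * (y - x)) \<and> P dvd d - (w + (j + 1) * (y - x)) \<or>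
      P dvd d - (w + j * (y - x)) \<and> P dvd c - (w + (j + 1) * (y - x))))"

lemma p_ge_7: "7 \<le> p" using p_mod by (metis mod_less_eq_dividend)

lemma P_ge_7: "7 \<le> P" using p_ge_7 P_def by simp

lemma odd_P: "odd P" using p_mod P_def by simp presburger

lemma not_dvd_small: "0 < a \<Longrightarrow> a < P \<Longrightarrow> \<not> P dvd a"
  by (simp add: zdvd_not_zless)

section \<open>The quadratic character when -1 is a nonresidue\<close>

lemma odd_half: "odd ((p - 1) div 2)" using p_mod by presburger

lemma Q_nonzero: "Q a \<Longrightarrow> \<not> P dvd a"
proof
  assume "Q a" "P dvd a"
  moreover have "0 < (p - 1) div 2" using p_ge_7 by simp
  ultimately have "P dvd a ^ ((p - 1) div 2)" by (meson dvd_power dvd_trans)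
  with \<open>Q a\<close> have "P dvd a ^ ((p - 1) div 2) - (a ^ ((p - 1) div 2) - 1)"
    unfolding Q_def by (rule dvd_diff[rotated])
  then have "P dvd 1" by simp
  then show False using prime_P by (simp add: not_prime_unit)
qed

lemma Q_mult_iff:
  assumes "Q a"
  shows "Q (a * b) \<longleftrightarrow> Q b"
proof -
  have "P dvd A * B - 1 \<longleftrightarrow> P dvd B - 1" if "P dvd A - 1" for A B
    using that by (intro iffI) Groebner_Basis.algebra+
  then show ?thesis using assms unfolding Q_def power_mult_distrib by blast
qed

lemma Q_mult: "Q a \<Longrightarrow> Q b \<Longrightarrow> Q (a * b)"
  by (simp add: Q_mult_iff)

lemma Q_mult_cancel: "Q (a * b) \<Longrightarrow> Q a \<Longrightarrow> Q b"
  by (simp add: Q_mult_iff)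

text \<open>By Fermat, \<open>a ^ h\<close> is 1 or -1 modulo \<open>P\<close>, and not both; the
  odd exponent \<open>h\<close> makes \<open>- a\<close> take the other value.\<close>

lemma Q_minus: "\<not> P dvd a \<Longrightarrow> Q (- a) \<longleftrightarrow> \<not> Q a"
proof -
  assume a: "\<not> P dvd a"
  define h where "h = (p - 1) div 2"
  have "[a ^ (p - 1) = 1] (mod P)"
  proof -
    have "\<not> p dvd nat (a mod P)"
    proof
      assume "p dvd nat (a mod P)"
      then have "P dvd int (nat (a mod P))" by (metis P_def int_dvd_int_iff)
      then have "P dvd a mod P" using P_ge_7 by simp
      then show False using a by (simp add: dvd_mod_iff)
    qed
    then have "[nat (a mod P) ^ (p - 1) = 1] (mod p)" by (rule fermat_theorem[OF prime_p])
    then have "[int (nat (a mod P) ^ (p - 1)) = int 1] (mod int p)" by (simp only: cong_int_iff)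
    then have "[(a mod P) ^ (p - 1) = 1] (mod P)" using P_ge_7 by (simp add: P_def)
    then show ?thesis by (simp add: cong_def power_mod)
  qed
  moreover have "p - 1 = h * 2" unfolding h_def using p_mod by presburger
  ultimately have "P dvd (a ^ h)\<^sup>2 - 1" by (simp add: cong_iff_dvd_diff power_mult)
  then have "P dvd (a ^ h - 1) * (a ^ h + 1)" by (simp add: algebra_simps power2_eq_square)
  then have "P dvd a ^ h - 1 \<or> P dvd a ^ h + 1" by (simp add: dvd_mult_P)
  moreover have "\<not> (P dvd a ^ h - 1 \<and> P dvd a ^ h + 1)"
  proof
    assume "P dvd a ^ h - 1 \<and> P dvd a ^ h + 1"
    then have "P dvd (a ^ h + 1) - (a ^ h - 1)" by (elim conjE) (rule dvd_diff)
    then have "P dvd 2" by simp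
    then show False using not_dvd_small[of 2] P_ge_7 by simp
  qed
  moreover have "(- a) ^ h = - (a ^ h)" using odd_half by (simp add: h_def)
  moreover have "P dvd - (a ^ h) - 1 \<longleftrightarrow> P dvd a ^ h + 1"
    by (metis add_uminus_conv_diff dvd_minus_iff minus_add_distrib)
  ultimately show "Q (- a) \<longleftrightarrow> \<not> Q a" unfolding Q_def h_def[symmetric] by auto
qed

lemma Q_square: "\<not> P dvd a \<Longrightarrow> Q (a * a)"
  using Q_mult[of a a] Q_mult[of "- a" "- a"] Q_minus[of a] by auto

lemma Q_cong: "P dvd a - b \<Longrightarrow> Q a \<Longrightarrow> Q b"
proof -
  assume "P dvd a - b" "Q a"
  then have "[a ^ ((p - 1) div 2) = b ^ ((p - 1) div 2)] (mod P)"
    by (intro cong_pow) (simp add: cong_iff_dvd_diff)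
  moreover have "P dvd B - 1" if "P dvd A - B" "P dvd A - 1" for A B
    using that by Groebner_Basis.algebra
  ultimately show "Q b" using \<open>Q a\<close> unfolding Q_def cong_iff_dvd_diff by blast
qed

lemma e_nonzero: "\<not> P dvd e" "\<not> P dvd 1 - e"
proof -
  have "\<not> P dvd 1" using not_dvd_small[of 1] P_ge_7 by simp
  moreover have "P dvd 1" if "P dvd e" using e that by Groebner_Basis.algebra
  moreover have "P dvd 1" if "P dvd 1 - e" using e that by Groebner_Basis.algebra
  ultimately show "\<not> P dvd e" "\<not> P dvd 1 - e" by blast+
qed

lemma not_dvd_3: "\<not> P dvd 3" using not_dvd_small[of 3] P_ge_7 by simp

section \<open>Orientation and cross ratio\<close>

lemma pos_cyclic: "pos x y z \<Longrightarrow> pos y z x"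
  unfolding pos_def by (simp add: ac_simps)

lemma pos_distinct: "pos x y z \<Longrightarrow> \<not> P dvd x - y \<and> \<not> P dvd y - z \<and> \<not> P dvd x - z"
  unfolding pos_def using Q_nonzero dvd_mult_P dvd_minus_iff[of P "x - z"] by fastforce

lemma pos_swap:
  assumes "\<not> P dvd x - y" "\<not> P dvd y - z" "\<not> P dvd x - z"
  shows "pos y x z \<longleftrightarrow> \<not> pos x y z"
proof -
  have "\<not> P dvd z - x" using assms(3) by (metis dvd_minus_iff minus_diff_eq)
  then have "\<not> P dvd (x - y) * (y - z) * (z - x)" using assms by (simp add: dvd_mult_P)
  moreover have "(y - x) * (x - z) * (z - y) = - ((x - y) * (y - z) * (z - x))"
    by (simp add: algebra_simps)
  ultimately show ?thesis unfolding pos_def by (simp add: Q_minus)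
qed

lemma not_pos_swap: "pos x y z \<Longrightarrow> \<not> pos y x z"
  using pos_swap[of x y z] pos_distinct[of x y z] by blast

text \<open>Rotating the first three points replaces the cross ratio \<open>c\<close> by
  \<open>1 / (1 - c)\<close>, which fixes \<open>e\<close> because
  \<open>e (1 - e) = 1\<close>.\<close>

lemma eqh_cyclic: "eqh x y z w \<Longrightarrow> eqh z x y w"
  unfolding eqh_def using e by Groebner_Basis.algebra

lemma eql_cyclic: "eql x y z \<Longrightarrow> eql z x y"
  unfolding eql_def using e by Groebner_Basis.algebra

lemma eqh_swap: "eqh x y z w \<longleftrightarrow> eqh y x w z"
  unfolding eqh_def by (simp add: algebra_simps)

lemma eqh_distinct:
  assumes "eqh x y z w" "\<not> P dvd x - y" "\<not> P dvd y - z" "\<not> P dvd x - z"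
  shows "\<not> P dvd x - w" "\<not> P dvd y - w" "\<not> P dvd z - w"
proof -
  have "P dvd (x - z) * (x - y)" if "P dvd x - w"
    using that assms(1) unfolding eqh_def by Groebner_Basis.algebra
  then show "\<not> P dvd x - w" using assms by (auto simp: dvd_mult_P)
  have "P dvd e * ((y - z) * (x - y))" if "P dvd y - w"
    using that assms(1) unfolding eqh_def by Groebner_Basis.algebra
  then show "\<not> P dvd y - w" using assms e_nonzero by (auto simp: dvd_mult_P)
  have "P dvd (1 - e) * ((x - z) * (y - z))" if "P dvd z - w"
    using that assms(1) unfolding eqh_def by Groebner_Basis.algebra
  then show "\<not> P dvd z - w" using assms e_nonzero by (auto simp: dvd_mult_P)
qed

text \<open>The two orientations are compared by the cross ratio, since \<open>- e = e\<^sup>4\<close> is a square.\<close>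

lemma pos_eqh:
  assumes "pos x y z" "eqh x y z w"
  shows "pos y x w"
proof -
  have d: "\<not> P dvd x - y" "\<not> P dvd y - z" "\<not> P dvd x - z" using pos_distinct[OF assms(1)] by auto
  note d' = eqh_distinct[OF assms(2) d]
  \<comment> \<open>The product of the two orientation terms is \<open>- e\<close> times the square
    of \<open>(x - y) * (y - z) * (x - w)\<close>; the factor \<open>e * e\<close> absorbs
    \<open>- e\<close>.\<close>
  define s where "s = e * e * (x - y) * (y - z) * (x - w)"
  have "\<not> P dvd s" unfolding s_def using d d' e_nonzero by (simp add: dvd_mult_P)
  then have "Q (s * s)" by (rule Q_square)
  moreover have "P dvd s * s - (x - y) * (y - z) * (z - x) * ((y - x) * (x - w) * (w - y))"
    using assms(2) e unfolding eqh_def s_def by Groebner_Basis.algebra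
  ultimately have "Q ((x - y) * (y - z) * (z - x) * ((y - x) * (x - w) * (w - y)))"
    using Q_cong by blast
  then show ?thesis using assms(1) Q_mult_cancel unfolding pos_def by blast
qed

text \<open>The first swap exchanges the two disjuncts, the second is such an exchange followed by a
  rotation, and the third reverses the orientation by \<open>pos_eqh\<close> while a double
  transposition keeps the cross ratio.\<close>

lemma K_swap: "K x y z w \<Longrightarrow> K y x z w" "K x y z w \<Longrightarrow> K x z y w" "K x y z w \<Longrightarrow> K x y w z"
proof -
  assume K: "K x y z w"
  then show "K y x z w" unfolding K_def by blast
  show "K x z y w" using K unfolding K_def by (meson pos_cyclic eqh_cyclic)
  show "K x y w z" using K unfolding K_def using pos_eqh eqh_swap by blast
qed

lemma D_swap: "D x y z w \<Longrightarrow> D y x z w" "D x y z w \<Longrightarrow> D x z y w"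
proof -
  assume D: "D x y z w"
  then show "D y x z w" unfolding D_def by (auto simp: ac_simps)
  show "D x z y w" using D unfolding D_def by (simp add: ac_simps) (meson pos_cyclic eql_cyclic)
qed

lemma pos_add: "pos (x + t) (y + t) (z + t) \<longleftrightarrow> pos x y z" unfolding pos_def by simp

lemma eql_add: "eql (x + t) (y + t) (z + t) \<longleftrightarrow> eql x y z" unfolding eql_def by simp

lemma eqh_add: "eqh (x + t) (y + t) (z + t) (w + t) \<longleftrightarrow> eqh x y z w" unfolding eqh_def by simp

lemma K_add: "K x y z w \<Longrightarrow> K (x + t) (y + t) (z + t) (w + t)"
  unfolding K_def by (simp add: pos_add eqh_add)

lemma D_add: "D x y z w \<Longrightarrow> D (x + t) (y + t) (z + t) (w + t)"
proof -
  assume "D x y z w"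
  moreover have "3 * (w + t) - (x + t + (y + t) + (z + t)) = 3 * w - (x + y + z)" by simp
  ultimately show ?thesis unfolding D_def by (simp only: pos_add eql_add)
qed

lemma M_add: "M x y c d \<Longrightarrow> M (x + t) (y + t) (c + t) (d + t)"
proof -
  assume "M x y c d"
  then obtain z w j where "D x y z w" "odd j" "0 < j" "j < P - 1"
     "P dvd c - (w + j * (y - x)) \<and> P dvd d - (w + (j + 1) * (y - x)) \<or>
      P dvd d - (w + j * (y - x)) \<and> P dvd c - (w + (j + 1) * (y - x))" unfolding M_def by blast
  moreover have "c + t - (w + t + i) = c - (w + i)" "y + t - (x + t) = y - x" for c w i by simp_all
  ultimately show ?thesis
    using D_add unfolding M_def by metis
qed

text \<open>With \<open>u = y - z\<close>, the sides of an equilateral triangle are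
  \<open>x - y = e^2 u\<close> and \<open>z - x = e^4 u\<close>, so their product is
  \<open>u^3\<close>; all have the character of \<open>u\<close>, and one side decides the
  orientation.\<close>

lemma pos_iff_Q_of_eql:
  assumes "eql x y z"
  shows "pos x y z \<longleftrightarrow> Q (x - y)"
proof -
  define u where "u = y - z"
  have 1: "P dvd (x - y) * (y - z) * (z - x) - u * u * u"
    using assms e unfolding eql_def u_def by Groebner_Basis.algebra
  have 2: "P dvd (x - y) - e * e * u" using assms e unfolding eql_def u_def by Groebner_Basis.algebra
  show ?thesis
  proof
    assume pos: "pos x y z"
    then have u: "\<not> P dvd u" unfolding u_def using pos_distinct by blast
    from pos have "Q (u * u * u)" unfolding pos_def using 1 Q_cong by blast
    then have "Q u" using Q_square[OF u] Q_mult_cancel by blast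
    then have "Q (e * e * u)" using Q_square[OF e_nonzero(1)] Q_mult by blast
    then show "Q (x - y)" using 2 Q_cong by (metis dvd_minus_iff minus_diff_eq)
  next
    assume "Q (x - y)"
    then have "Q (e * e * u)" using 2 Q_cong by blast
    then have "Q u" using Q_square[OF e_nonzero(1)] Q_mult_cancel by blast
    then have "Q (u * u * u)" using Q_mult by blast
    then show "pos x y z" unfolding pos_def using 1 Q_cong by (metis dvd_minus_iff minus_diff_eq)
  qed
qed

lemma D_iff: "D x y z w \<longleftrightarrow> P dvd 3 * w - (x + y + z) \<and> (Q (x - y) \<and> eql x y z \<or> Q (y - x) \<and> eql y x z)"
  unfolding D_def using pos_iff_Q_of_eql by blast

lemma not_Q_swap: "Q (x - y) \<Longrightarrow> \<not> Q (y - x)"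
  using Q_minus[of "x - y"] Q_nonzero by simp

lemma D_ex: "\<not> P dvd x - y \<Longrightarrow> \<exists>z w. D x y z w"
proof -
  have *: "\<exists>z w. D x y z w" if Q: "Q (x - y)" for x y
  proof -
    obtain z where "P dvd (1 - e) * z - (x - e * y)" using ex_div e_nonzero by blast
    then have "eql x y z" unfolding eql_def by Groebner_Basis.algebra
    moreover obtain w where "P dvd 3 * w - (x + y + z)" using ex_div not_dvd_3 by blast
    ultimately show ?thesis using Q unfolding D_iff by blast
  qed
  assume "\<not> P dvd x - y"
  then have "Q (x - y) \<or> Q (y - x)" using Q_minus[of "x - y"] by auto
  then show ?thesis using * D_swap(1) by blast
qed

text \<open>Exactly one of \<open>x - y\<close> and \<open>y - x\<close> is a square, so two points
  lie in only one correctly oriented equilateral triangle, which then fixes the centre.\<close>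

lemma D_third_unique:
  assumes "D x y z w" "D x y z' w'"
  shows "P dvd z - z'" "P dvd w - w'"
proof -
  have "P dvd z - z'" if "eql x y z" "eql x y z'" for x y
  proof -
    have "P dvd (1 - e) * (z - z')" using that unfolding eql_def by Groebner_Basis.algebra
    then show ?thesis using e_nonzero by (simp add: dvd_mult_P)
  qed
  then show z: "P dvd z - z'" using assms not_Q_swap unfolding D_iff by blast
  then have "P dvd 3 * (w - w')" using assms unfolding D_iff by Groebner_Basis.algebra
  then show "P dvd w - w'" using not_dvd_3 dvd_mult_P by blast
qed

lemma D_cong:
  "D x y z w \<Longrightarrow> P dvd w - w' \<Longrightarrow> D x y z w'"
  "D x y z w \<Longrightarrow> P dvd z - z' \<Longrightarrow> D x y z' w"
proof -
  assume D: "D x y z w"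
  have "P dvd 3 * w' - (x + y + z)" if "P dvd w - w'" "P dvd 3 * w - (x + y + z)"
    using that by Groebner_Basis.algebra
  then show "D x y z w'" if "P dvd w - w'" using D that unfolding D_iff by blast
  assume z: "P dvd z - z'"
  have "P dvd 3 * w - (x + y + z')" if "P dvd 3 * w - (x + y + z)"
    using that z by Groebner_Basis.algebra
  moreover have "eql x y z'" if "eql x y z" for x y
    using that z unfolding eql_def by Groebner_Basis.algebra
  ultimately show "D x y z' w" using D unfolding D_iff by blast
qed

lemma D_distinct: "D x y z w \<Longrightarrow> \<not> P dvd x - y \<and> \<not> P dvd y - z \<and> \<not> P dvd x - z"
  unfolding D_def using pos_distinct[of x y z] pos_distinct[of y x z] dvd_minus_iff[of P "x - y"] by auto

lemma M_swap: "M x y c d \<Longrightarrow> M y x c d" "M x y c d \<Longrightarrow> M x y d c"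
proof -
  assume M: "M x y c d"
  then show "M x y d c" unfolding M_def by blast
  from M obtain z w j where 1: "D x y z w" "odd j" "0 < j" "j < P - 1" and
     2: "P dvd c - (w + j * (y - x)) \<and> P dvd d - (w + (j + 1) * (y - x)) \<or>
      P dvd d - (w + j * (y - x)) \<and> P dvd c - (w + (j + 1) * (y - x))" unfolding M_def by blast
  \<comment> \<open>Reversing the step \<open>y - x\<close> turns index \<open>j\<close> into
    \<open>P - j\<close>, so the pair \<open>j\<close>, \<open>j + 1\<close> becomes
    \<open>P - 1 - j\<close>, \<open>P - j\<close>; its lower index is odd again because
    \<open>P\<close> is odd.\<close>
  have "P dvd c - (w + (P - 1 - j) * (x - y))" if "P dvd c - (w + (j + 1) * (y - x))" for c
    using that by Groebner_Basis.algebra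
  moreover have "P dvd c - (w + (P - 1 - j + 1) * (x - y))" if "P dvd c - (w + j * (y - x))" for c
    using that by Groebner_Basis.algebra
  moreover have "odd (P - 1 - j)" using 1(2) odd_P by simp
  moreover have "0 < P - 1 - j" "P - 1 - j < P - 1" using 1 by simp_all
  moreover have "D y x z w" using 1(1) D_swap by blast
  ultimately show "M y x c d" using 2 unfolding M_def by blast
qed

text \<open>Pairing neighbours makes \<open>d - c\<close> congruent to \<open>y - x\<close>. Hence
  \<open>- d\<close>, \<open>- c\<close> is the translate of \<open>x\<close>, \<open>y\<close> by
  \<open>t\<close>, its triangle is the translated one, and \<open>- y\<close>, \<open>- x\<close>
  have the same indices \<open>j\<close>, \<open>j + 1\<close> relative to the new centre.\<close>

lemma M_minus: "M x y c d \<Longrightarrow> M (- c) (- d) (- x) (- y)"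
proof -
  have *: "M (- c) (- d) (- x) (- y)"
    if D: "D x y z w" and j: "odd j" "0 < j" "j < P - 1"
      and cd: "P dvd c - (w + j * (y - x))" "P dvd d - (w + (j + 1) * (y - x))" for z w j c d
  proof -
    define t where "t = - d - x"
    have "D (x + t) (z + t) (y + t) (w + t)" using D D_swap D_add by blast
    moreover have "P dvd (y + t) - (- c)" using cd unfolding t_def by Groebner_Basis.algebra
    ultimately have "D (- d) (z + t) (- c) (w + t)" unfolding t_def using D_cong(2) by fastforce
    then have "D (- d) (- c) (z + t) (w + t)" by (rule D_swap)
    moreover have "P dvd - y - (w + t + j * (- c - (- d)))" "P dvd - x - (w + t + (j + 1) * (- c - (- d)))"
      using cd unfolding t_def by Groebner_Basis.algebra+
    ultimately have "M (- d) (- c) (- y) (- x)" using j unfolding M_def by blast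
    then show ?thesis using M_swap by blast
  qed
  assume "M x y c d"
  then show ?thesis unfolding M_def[of x y] using * M_swap by blast
qed

text \<open>The cross ratio condition is linear in \<open>w\<close>; if its leading coefficient
  vanishes, the solution is at infinity and the triangle is equilateral.\<close>

lemma eqh_or_eql: "(\<exists>w. eqh x y z w) \<or> eql x y z"
proof (cases "eql x y z")
  case False
  then have "\<not> P dvd (x - z) - e * (y - z)" unfolding eql_def .
  then obtain w where "P dvd ((x - z) - e * (y - z)) * w - ((x - z) * y - e * (y - z) * x)"
    using ex_div by blast
  then have "eqh x y z w" unfolding eqh_def by Groebner_Basis.algebra
  then show ?thesis by blast
qed simp

lemma not_eqh_eql: "pos x y z \<Longrightarrow> eqh x y z w \<Longrightarrow> \<not> eql x y z"
proof
  assume "pos x y z" "eqh x y z w" "eql x y z"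
  then have "P dvd e * ((y - z) * (x - y))" unfolding eqh_def eql_def by Groebner_Basis.algebra
  then show False using pos_distinct[OF \<open>pos x y z\<close>] e_nonzero by (simp add: dvd_mult_P)
qed

lemma eqh_unique: "pos x y z \<Longrightarrow> eqh x y z w \<Longrightarrow> eqh x y z w' \<Longrightarrow> P dvd w - w'"
proof -
  assume *: "pos x y z" "eqh x y z w" "eqh x y z w'"
  then have "P dvd ((x - z) - e * (y - z)) * (w - w')" unfolding eqh_def by Groebner_Basis.algebra
  then show ?thesis using not_eqh_eql[OF *(1,2)] dvd_mult_P unfolding eql_def by blast
qed

lemma small_multiple_eq:
  assumes "P dvd (i - i') * d" "\<not> P dvd d" "0 < i" "i < P" "0 < i'" "i' < P"
  shows "i = i'"
proof -
  have "P dvd i - i'" using assms(1,2) dvd_mult_P by blast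
  then have "i mod P = i' mod P" by (simp add: mod_eq_dvd_iff)
  then show ?thesis using assms(3-6) by simp
qed

text \<open>The triangle hidden in \<open>M\<close> may be replaced by any given one on
  \<open>x\<close>, \<open>y\<close>, since they agree modulo \<open>P\<close>. The index of
  \<open>c\<close> then determines that of \<open>d\<close>: an odd index is paired upwards, an even
  one downwards.\<close>

lemma M_E:
  assumes "M x y c d" "D x y z w"
  obtains i where "0 < i" "i < P" "P dvd c - (w + i * (y - x))"
    "P dvd d - (w + (if odd i then i + 1 else i - 1) * (y - x))"
proof -
  obtain z' w' j where 1: "D x y z' w'" "odd j" "0 < j" "j < P - 1" and
     2: "P dvd c - (w' + j * (y - x)) \<and> P dvd d - (w' + (j + 1) * (y - x)) \<or>
      P dvd d - (w' + j * (y - x)) \<and> P dvd c - (w' + (j + 1) * (y - x))"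
    using assms(1) unfolding M_def by blast
  have w: "P dvd w' - w" using D_third_unique 1(1) assms(2) by blast
  have "P dvd c - (w + i * (y - x))" if "P dvd c - (w' + i * (y - x))" for c i
    using that w by Groebner_Basis.algebra
  with 2 have "P dvd c - (w + j * (y - x)) \<and> P dvd d - (w + (j + 1) * (y - x)) \<or>
      P dvd d - (w + j * (y - x)) \<and> P dvd c - (w + (j + 1) * (y - x))" by blast
  then show ?thesis using that[of j] that[of "j + 1"] 1 by auto
qed

lemma M_D: "M x y c d \<Longrightarrow> \<not> D x y z c"
proof
  assume M: "M x y c d" and D: "D x y z c"
  obtain i where i: "0 < i" "i < P" "P dvd c - (c + i * (y - x))" using M_E[OF M D] .
  then have "P dvd i * (x - y)" by Groebner_Basis.algebra
  then show False using D_distinct[OF D] not_dvd_small[OF i(1,2)] by (simp add: dvd_mult_P)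
qed

lemma M_unique:
  assumes "M x y c d" "M x y c d'"
  shows "P dvd d - d'"
proof -
  obtain z w where D: "D x y z w" using assms(1) unfolding M_def by blast
  obtain i where i: "0 < i" "i < P" "P dvd c - (w + i * (y - x))"
    "P dvd d - (w + (if odd i then i + 1 else i - 1) * (y - x))" using M_E[OF assms(1) D] .
  obtain i' where i': "0 < i'" "i' < P" "P dvd c - (w + i' * (y - x))"
    "P dvd d' - (w + (if odd i' then i' + 1 else i' - 1) * (y - x))" using M_E[OF assms(2) D] .
  have "P dvd (i - i') * (x - y)" using i(3) i'(3) by Groebner_Basis.algebra
  then have "i = i'" using small_multiple_eq[of i i' "x - y"] D_distinct[OF D] i i' by blast
  moreover have "P dvd d - d'" if "P dvd d - v" "P dvd d' - v" for v
    using that by Groebner_Basis.algebra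
  ultimately show ?thesis using i(4) i'(4) by blast
qed

lemma mixed_ex:
  assumes "\<not> P dvd x - y"
  shows "(\<exists>z. D x y z c) \<or> (\<exists>d. M x y c d)"
proof -
  obtain z w where D: "D x y z w" using D_ex[OF assms] by blast
  have "\<not> P dvd y - x" using assms by (metis dvd_minus_iff minus_diff_eq)
  then obtain t where t: "P dvd (y - x) * t - (c - w)" using ex_div by blast
  define i where "i = t mod P"
  have i: "0 \<le> i" "i < P" using P_ge_7 by (simp_all add: i_def)
  have "P dvd t - i" unfolding i_def by (simp add: mod_eq_dvd_iff[symmetric])
  with t have ci: "P dvd c - (w + i * (y - x))" by Groebner_Basis.algebra
  consider "i = 0" | "0 < i" "odd i" | "0 < i" "even i" using i(1) by fastforce
  then show ?thesis
  proof cases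
    case 1
    then have "P dvd w - c" using ci by (simp add: dvd_diff_commute)
    then show ?thesis using D D_cong(1) by blast
  next
    case 2
    \<comment> \<open>The last index \<open>P - 1\<close> is even, so an odd index always has an
      upper neighbour below \<open>P\<close>.\<close>
    then have "i \<noteq> P - 1" using odd_P by auto
    then have "M x y c (w + (i + 1) * (y - x))"
      unfolding M_def using D 2 i ci by (intro exI[of _ z] exI[of _ w] exI[of _ i]) simp
    then show ?thesis by blast
  next
    case 3
    then have "odd (i - 1)" "0 < i - 1" "i - 1 < P - 1" using i by (auto elim!: evenE)
    moreover have "i - 1 + 1 = i" by simp
    ultimately have "M x y c (w + (i - 1) * (y - x))"
      unfolding M_def using D ci by (metis diff_self dvd_0_right)
    then show ?thesis by blast
  qed
qed

sublocale doubling p K D M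
proof (unfold_locales, unfold P_def[symmetric] cong_iff_dvd_diff)
  show "prime p" "4 < p" using prime_p p_ge_7 by simp_all
next
  fix x y z w assume "K x y z w"
  then show "K y x z w" "K x z y w" "K x y w z" by (fact K_swap)+
next
  fix x y z w assume "D x y z w"
  then show "D y x z w" "D x z y w" by (fact D_swap)+
next
  fix x y c d assume "M x y c d"
  then show "M y x c d" "M x y d c" by (fact M_swap)+
next
  fix x y c d assume "M x y c d"
  then show "M (- c) (- d) (- x) (- y)" by (fact M_minus)
next
  fix x y z w t assume "K x y z w"
  then show "K (x + t) (y + t) (z + t) (w + t)" by (fact K_add)
next
  fix x y z w t assume "D x y z w"
  then show "D (x + t) (y + t) (z + t) (w + t)" by (fact D_add)
next
  fix x y c d t assume "M x y c d"
  then show "M (x + t) (y + t) (c + t) (d + t)" by (fact M_add)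
next
  fix x y z w w' assume *: "K x y z w" "P dvd w - w'"
  have "eqh x y z w'" if "eqh x y z w" for x y
    using that *(2) unfolding eqh_def by Groebner_Basis.algebra
  then show "K x y z w'" using *(1) unfolding K_def by blast
next
  fix x y z w w' assume "D x y z w" "P dvd w - w'"
  then show "D x y z w'" by (fact D_cong)
next
  fix x y z w z' assume "D x y z w" "P dvd z - z'"
  then show "D x y z' w" by (fact D_cong)
next
  fix x y c d d' assume *: "M x y c d" "P dvd d - d'"
  have "P dvd d' - v" if "P dvd d - v" for v using that *(2) by Groebner_Basis.algebra
  then show "M x y c d'" using *(1) unfolding M_def by blast
next
  fix x y z w assume "K x y z w"
  then show "\<not> P dvd z - w" unfolding K_def using eqh_distinct(3) pos_distinct by blast
next
  fix x y z w assume "D x y z w"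
  then show "\<not> P dvd y - z" using D_distinct by blast
next
  fix x y c d assume M: "M x y c d"
  show "\<not> P dvd c - d"
  proof
    assume cd: "P dvd c - d"
    have "P dvd x - y" if "P dvd c - (w + j * (y - x))" "P dvd d - (w + (j + 1) * (y - x))" for w j
      using that cd by Groebner_Basis.algebra
    moreover have "P dvd x - y" if "P dvd d - (w + j * (y - x))" "P dvd c - (w + (j + 1) * (y - x))" for w j
      using that cd by Groebner_Basis.algebra
    ultimately have "P dvd x - y" using M unfolding M_def by blast
    then show False using M D_distinct unfolding M_def by blast
  qed
next
  fix x y z assume "\<not> P dvd x - y" "\<not> P dvd x - z" "\<not> P dvd y - z"
  then have "pos x y z \<or> pos y x z" using pos_swap by blast
  moreover have "\<exists>w. P dvd 3 * w - (x + y + z)" using ex_div not_dvd_3 by blast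
  ultimately show "(\<exists>w. K x y z w) \<or> (\<exists>w. D x y z w)"
    unfolding K_def D_def using eqh_or_eql by blast
next
  fix x y z w w' assume "K x y z w"
  then show "\<not> D x y z w'" unfolding K_def D_def using not_eqh_eql not_pos_swap by blast
next
  fix x y z w w' assume "K x y z w" "K x y z w'"
  then show "P dvd w - w'" unfolding K_def using eqh_unique not_pos_swap by blast
next
  fix x y z w w' assume "D x y z w" "D x y z w'"
  then show "P dvd w - w'" by (fact D_third_unique)
next
  fix x y c assume "\<not> P dvd x - y"
  then show "(\<exists>z. D x y z c) \<or> (\<exists>d. M x y c d)" by (fact mixed_ex)
next
  fix x y c d z assume "M x y c d"
  then show "\<not> D x y z c" by (fact M_D)
next
  fix x y c d d' assume "M x y c d" "M x y c d'"
  then show "P dvd d - d'" by (fact M_unique)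
next
  fix x y z c z' assume "D x y z c" "D x y z' c"
  then show "P dvd z - z'" by (fact D_third_unique)
qed

end

lemma strictly_cyclic_SQS_7_mod_12:
  assumes "prime p" "p mod 12 = 7"
  shows "\<exists>S. strictly_cyclic_SQS 2 p S"
proof -
  have "p mod 3 = 1" using assms(2) by presburger
  then obtain e where "int p dvd e\<^sup>2 - e + 1" using primitive_sixth_root_exists assms(1) by blast
  then interpret equianharmonic p "int p" e using assms by unfold_locales auto
  show ?thesis using strictly_cyclic_blocks by blast
qed

section \<open>Harmonic quadruples and affine-invariant families\<close>

text \<open>\<open>G l m\<close> stands for a block on 0, 1, \<open>l\<close>, \<open>m\<close>, the
  normal form under affine maps. \<open>G_sym\<close>, \<open>G_complement\<close> and
  \<open>G_reciprocal\<close> express the swaps of the last two points, of 0 and 1, and of 1 and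
  \<open>l\<close>. The domain leaves out 0 and 1, where points coincide, and -1, 2, 1/2, where 0,
  1, \<open>l\<close> form an arithmetic progression in some order.\<close>

locale affine_quadruples = prime_modulus +
  fixes G :: "int \<Rightarrow> int \<Rightarrow> bool"
  assumes p_ge_5: "5 \<le> p"
    and G_cong: "G l m \<Longrightarrow> P dvd l - l' \<Longrightarrow> P dvd m - m' \<Longrightarrow> G l' m'"
    and G_sym: "G l m \<Longrightarrow> G m l"
    and G_complement: "G l m \<Longrightarrow> G (1 - l) (1 - m)"
    and G_reciprocal: "G l m \<Longrightarrow> P dvd l * k - 1 \<Longrightarrow> G k (m * k)"
    and G_irrefl: "G l m \<Longrightarrow> \<not> P dvd l - m"
    and G_unique: "G l m \<Longrightarrow> G l m' \<Longrightarrow> P dvd m - m'"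
    and G_domain: "(\<exists>m. G l m) \<longleftrightarrow>
      \<not> P dvd l \<and> \<not> P dvd l - 1 \<and> \<not> P dvd l + 1 \<and> \<not> P dvd l - 2 \<and> \<not> P dvd 2 * l - 1"
begin

definition K :: "int \<Rightarrow> int \<Rightarrow> int \<Rightarrow> int \<Rightarrow> bool" where
  "K x y z w \<longleftrightarrow> \<not> P dvd x - y \<and>
     (\<exists>l m. G l m \<and> P dvd (z - x) - l * (y - x) \<and> P dvd (w - x) - m * (y - x))"

definition D :: "int \<Rightarrow> int \<Rightarrow> int \<Rightarrow> int \<Rightarrow> bool" where
  "D x y z w \<longleftrightarrow> \<not> P dvd x - y \<and> \<not> P dvd y - z \<and> \<not> P dvd x - z \<and>
     (P dvd w - x \<and> P dvd y + z - 2 * x \<or> P dvd w - y \<and> P dvd x + z - 2 * y \<or>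
      P dvd w - z \<and> P dvd x + y - 2 * z)"

text \<open>Cross ratio -1, cleared of denominators.\<close>

definition M :: "int \<Rightarrow> int \<Rightarrow> int \<Rightarrow> int \<Rightarrow> bool" where
  "M x y c d \<longleftrightarrow> \<not> P dvd x - y \<and> \<not> P dvd c - d \<and> P dvd (x - c) * (y - d) + (x - d) * (y - c)"

lemma P_ge_5: "5 \<le> P" using p_ge_5 P_def by simp

lemma not_dvd_small: "\<not> P dvd 2" "\<not> P dvd 3"
  using P_ge_5 zdvd_not_zless[of 2 P] zdvd_not_zless[of 3 P] by auto

lemma dvd_swap: "P dvd a - b \<longleftrightarrow> P dvd b - a"
  by (rule dvd_diff_commute)

lemma G_nonzero: "G l m \<Longrightarrow> \<not> P dvd l"
  using G_domain by blast

lemma K_swap: "K x y z w \<Longrightarrow> K y x z w" "K x y z w \<Longrightarrow> K x z y w" "K x y z w \<Longrightarrow> K x y w z"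
proof -
  assume "K x y z w"
  then obtain l m where lm: "\<not> P dvd x - y" "G l m" "P dvd (z - x) - l * (y - x)" "P dvd (w - x) - m * (y - x)"
    unfolding K_def by blast
  show "K x y w z" using lm G_sym unfolding K_def by blast
  have "P dvd (z - y) - (1 - l) * (x - y)" "P dvd (w - y) - (1 - m) * (x - y)"
    using lm(3,4) by Groebner_Basis.algebra+
  moreover have "\<not> P dvd y - x" using lm(1) dvd_swap by blast
  ultimately show "K y x z w" using G_complement[OF lm(2)] unfolding K_def by blast
  obtain k where k: "P dvd l * k - 1" using ex_div G_nonzero[OF lm(2)] by blast
  have "P dvd l * (x - y)" if "P dvd x - z" using that lm(3) by Groebner_Basis.algebra
  then have "\<not> P dvd x - z" using lm(1) G_nonzero[OF lm(2)] dvd_mult_P by blast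
  moreover have "P dvd (y - x) - k * (z - x)" "P dvd (w - x) - (m * k) * (z - x)"
    using lm(3,4) k by Groebner_Basis.algebra+
  ultimately show "K x z y w" using G_reciprocal[OF lm(2) k] unfolding K_def by blast
qed

lemma K_ratio:
  assumes "\<not> P dvd x - y" "P dvd (z - x) - l * (y - x)" "P dvd (z - x) - l' * (y - x)"
  shows "P dvd l - l'"
proof -
  have "P dvd (l - l') * (x - y)" using assms(2,3) by Groebner_Basis.algebra
  then show ?thesis using assms(1) dvd_mult_P by blast
qed

lemma K_D:
  assumes "K x y z w"
  shows "\<not> D x y z w'"
proof
  assume D: "D x y z w'"
  obtain l m where lm: "\<not> P dvd x - y" "G l m" "P dvd (z - x) - l * (y - x)"
    using assms unfolding K_def by blast
  have "P dvd (l + 1) * (x - y)" if "P dvd y + z - 2 * x"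
    using that lm(3) by Groebner_Basis.algebra
  moreover have "P dvd (l - 2) * (x - y)" if "P dvd x + z - 2 * y"
    using that lm(3) by Groebner_Basis.algebra
  moreover have "P dvd (2 * l - 1) * (x - y)" if "P dvd x + y - 2 * z"
    using that lm(3) by Groebner_Basis.algebra
  ultimately have "P dvd l + 1 \<or> P dvd l - 2 \<or> P dvd 2 * l - 1"
    using D lm(1) dvd_mult_P unfolding D_def by blast
  then show False using G_domain lm(2) by blast
qed

lemma pure_ex:
  assumes "\<not> P dvd x - y" "\<not> P dvd x - z" "\<not> P dvd y - z"
  shows "(\<exists>w. K x y z w) \<or> (\<exists>w. D x y z w)"
proof -
  have "\<not> P dvd y - x" using assms(1) dvd_swap by blast
  then obtain l where l: "P dvd (y - x) * l - (z - x)" using ex_div by blast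
  then have l': "P dvd (z - x) - l * (y - x)" by Groebner_Basis.algebra
  have "P dvd x - z" if "P dvd l" using that l by Groebner_Basis.algebra
  moreover have "P dvd y - z" if "P dvd l - 1" using that l by Groebner_Basis.algebra
  moreover have "P dvd y + z - 2 * x" if "P dvd l + 1" using that l by Groebner_Basis.algebra
  moreover have "P dvd x + z - 2 * y" if "P dvd l - 2" using that l by Groebner_Basis.algebra
  moreover have "P dvd x + y - 2 * z" if "P dvd 2 * l - 1" using that l by Groebner_Basis.algebra
  ultimately consider m where "G l m" | "P dvd y + z - 2 * x" | "P dvd x + z - 2 * y" | "P dvd x + y - 2 * z"
    using assms G_domain by blast
  then show ?thesis
  proof cases
    case (1 m)
    moreover have "P dvd (x + m * (y - x) - x) - m * (y - x)" by simp
    ultimately have "K x y z (x + m * (y - x))" using l' assms(1) unfolding K_def by blast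
    then show ?thesis by blast
  next
    case 2
    then have "D x y z x" using assms unfolding D_def by simp
    then show ?thesis by blast
  next
    case 3
    then have "D x y z y" using assms unfolding D_def by simp
    then show ?thesis by blast
  next
    case 4
    then have "D x y z z" using assms unfolding D_def by simp
    then show ?thesis by blast
  qed
qed

text \<open>Two different midpoints in one triple would force characteristic 3.\<close>

lemma midpoint_unique:
  assumes "P dvd y + z - 2 * x" "P dvd x + z - 2 * y"
  shows "P dvd x - y"
proof -
  have "P dvd 3 * (x - y)" using assms by Groebner_Basis.algebra
  then show ?thesis using not_dvd_small dvd_mult_P by blast
qed

lemma D_unique:
  assumes "D x y z w" "D x y z w'"
  shows "P dvd w - w'"
proof -
  have same: "P dvd w - w'" if "P dvd w - v" "P dvd w' - v" for v
    using that by Groebner_Basis.algebra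
  have "P dvd x - y" if "P dvd y + z - 2 * x" "P dvd x + z - 2 * y" using that by (rule midpoint_unique)
  moreover have "P dvd x - z" if "P dvd y + z - 2 * x" "P dvd x + y - 2 * z"
    using that midpoint_unique[of z y x] by (simp add: add.commute)
  moreover have "P dvd y - z" if "P dvd x + z - 2 * y" "P dvd x + y - 2 * z"
    using that midpoint_unique[of z x y] by (simp add: add.commute)
  ultimately show ?thesis using assms same unfolding D_def by metis
qed

lemma M_harmonic: "M x y c d \<Longrightarrow> P dvd (x - c) * (y - d) + (x - d) * (y - c)"
  unfolding M_def by blast

text \<open>The harmonic conjugate of the midpoint is the point at infinity.\<close>

lemma not_M_midpoint: "M x y c d \<Longrightarrow> \<not> P dvd x + y - 2 * c"
proof
  assume M: "M x y c d" and "P dvd x + y - 2 * c"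
  then have "P dvd (x - y) * (x - y)" using M_harmonic[OF M] by Groebner_Basis.algebra
  then show False using M dvd_mult_P unfolding M_def by blast
qed

lemma M_distinct: "M x y c d \<Longrightarrow> \<not> P dvd c - x" "M x y c d \<Longrightarrow> \<not> P dvd c - y"
proof -
  assume M: "M x y c d"
  have "P dvd (x - y) * (c - d)" if "P dvd c - x" 
    using M_harmonic[OF M] that by Groebner_Basis.algebra
  then show "\<not> P dvd c - x" using M dvd_mult_P unfolding M_def by blast
  have "P dvd (x - y) * (c - d)" if "P dvd c - y" 
    using M_harmonic[OF M] that by Groebner_Basis.algebra
  then show "\<not> P dvd c - y" using M dvd_mult_P unfolding M_def by blast
qed

text \<open>A block of \<open>D\<close> on \<open>x\<close>, \<open>y\<close> has \<open>c\<close>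
  equal to \<open>x\<close>, \<open>y\<close> or their midpoint: the first two are fixed by harmonic
  conjugation and the third goes to infinity, so \<open>M\<close> misses exactly these.\<close>

lemma M_D:
  assumes "M x y c d"
  shows "\<not> D x y z c"
proof
  assume D: "D x y z c"
  have "P dvd x + y - 2 * c" if "P dvd c - z" "P dvd x + y - 2 * z"
    using that by Groebner_Basis.algebra
  then show False using D M_distinct[OF assms] not_M_midpoint[OF assms] unfolding D_def by blast
qed

lemma M_unique:
  assumes "M x y c d" "M x y c d'"
  shows "P dvd d - d'"
proof -
  have "P dvd (x + y - 2 * c) * (d - d')"
    using assms[THEN M_harmonic] by Groebner_Basis.algebra
  then show ?thesis using not_M_midpoint[OF assms(1)] dvd_mult_P by blast
qed

lemma D_swap: "D x y z w \<Longrightarrow> D y x z w" "D x y z w \<Longrightarrow> D x z y w"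
  unfolding D_def using dvd_swap[of x y] dvd_swap[of y z] by (auto simp: add.commute)

lemma mixed_ex:
  assumes xy: "\<not> P dvd x - y"
  shows "(\<exists>z. D x y z c) \<or> (\<exists>d. M x y c d)"
proof -
  have end_point: "\<exists>z. D x y z c" if "\<not> P dvd x - y" "P dvd c - x" for x y
  proof -
    \<comment> \<open>The witness \<open>2 * x - y\<close> is the reflection of \<open>y\<close> in
      \<open>x\<close>, making \<open>x\<close> the midpoint.\<close>
    have "P dvd x - y" if "P dvd x - (2 * x - y)" using that by Groebner_Basis.algebra
    moreover have "P dvd 2 * (x - y)" if "P dvd y - (2 * x - y)" using that by Groebner_Basis.algebra
    moreover have "P dvd y + (2 * x - y) - 2 * x" by simp
    ultimately have "D x y (2 * x - y) c" using that not_dvd_small(1) dvd_mult_P unfolding D_def by blast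
    then show ?thesis by blast
  qed
  consider "P dvd c - x" | "P dvd c - y" | "P dvd x + y - 2 * c"
    | "\<not> P dvd c - x" "\<not> P dvd c - y" "\<not> P dvd x + y - 2 * c" by blast
  then show ?thesis
  proof cases
    case 1
    then show ?thesis using end_point xy by blast
  next
    case 2
    then obtain z where "D y x z c" using end_point[of y x] xy dvd_swap by blast
    then show ?thesis using D_swap(1) by blast
  next
    case 3
    then have "P dvd x - y" if "P dvd y - c \<or> P dvd x - c"
      using that by (elim disjE) (Groebner_Basis.algebra, Groebner_Basis.algebra)
    then have "D x y c c" using 3 xy unfolding D_def by auto
    then show ?thesis by blast
  next
    case 4
    \<comment> \<open>For fixed \<open>c\<close> the harmonic condition is linear in
      \<open>d\<close>; away from the midpoint its leading coefficient is invertible.\<close>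
    obtain d where "P dvd (x + y - 2 * c) * d - (2 * x * y - (x + y) * c)" using ex_div 4(3) by blast
    then have *: "P dvd (x - c) * (y - d) + (x - d) * (y - c)" by Groebner_Basis.algebra
    have "P dvd 2 * ((c - x) * (c - y))" if "P dvd c - d" using that * by Groebner_Basis.algebra
    then have "\<not> P dvd c - d" using 4(1,2) not_dvd_small(1) dvd_mult_P by blast
    then show ?thesis using * xy unfolding M_def by blast
  qed
qed

lemma D_third_unique:
  assumes "D x y z c" "D x y z' c"
  shows "P dvd z - z'"
proof -
  have *: "P dvd z - z'" if "P dvd y + z - 2 * x" "P dvd y + z' - 2 * x" for x y
    using that by Groebner_Basis.algebra
  have "P dvd z - z'" if "P dvd c - z" "P dvd c - z'" using that by Groebner_Basis.algebra
  moreover have "P dvd x - y" if "P dvd c - x" "P dvd c - y" for x y using that by Groebner_Basis.algebra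
  ultimately show ?thesis using assms * unfolding D_def by blast
qed

sublocale doubling p K D M
proof (unfold_locales, unfold P_def[symmetric] cong_iff_dvd_diff)
  show "prime p" "4 < p" using prime_p p_ge_5 by simp_all
next
  fix x y z w assume "K x y z w"
  then show "K y x z w" "K x z y w" "K x y w z" by (fact K_swap)+
next
  fix x y z w assume "D x y z w"
  then show "D y x z w" "D x z y w" by (fact D_swap)+
next
  fix x y c d assume "M x y c d"
  then show "M y x c d" "M x y d c" "M (- c) (- d) (- x) (- y)"
    unfolding M_def using dvd_swap[of x y] dvd_swap[of c d] by (auto simp: algebra_simps)
next
  fix x y z w t assume "K x y z w"
  then show "K (x + t) (y + t) (z + t) (w + t)" unfolding K_def by simp
next
  fix x y z w t assume "D x y z w"
  then show "D (x + t) (y + t) (z + t) (w + t)" unfolding D_def by (simp add: algebra_simps)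
next
  fix x y c d t assume "M x y c d"
  then show "M (x + t) (y + t) (c + t) (d + t)" unfolding M_def by simp
next
  fix x y z w w' assume *: "K x y z w" "P dvd w - w'"
  have "P dvd (w' - x) - v" if "P dvd (w - x) - v" for v using that *(2) by Groebner_Basis.algebra
  then show "K x y z w'" using *(1) unfolding K_def by blast
next
  fix x y z w w' assume *: "D x y z w" "P dvd w - w'"
  have "P dvd w' - v" if "P dvd w - v" for v using that *(2) by Groebner_Basis.algebra
  then show "D x y z w'" using *(1) unfolding D_def by blast
next
  fix x y z w z' assume *: "D x y z w" "P dvd z - z'"
  have "P dvd y - z" if "P dvd y - z'" for y using that *(2) by Groebner_Basis.algebra
  moreover have "P dvd w - z'" if "P dvd w - z" using that *(2) by Groebner_Basis.algebra
  moreover have "P dvd y + z' - 2 * x" if "P dvd y + z - 2 * x" for x y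
    using that *(2) by Groebner_Basis.algebra
  moreover have "P dvd x + y - 2 * z'" if "P dvd x + y - 2 * z" using that *(2) by Groebner_Basis.algebra
  ultimately show "D x y z' w" using *(1) unfolding D_def by blast
next
  fix x y c d d' assume *: "M x y c d" "P dvd d - d'"
  have "P dvd (x - c) * (y - d') + (x - d') * (y - c)" if "P dvd (x - c) * (y - d) + (x - d) * (y - c)"
    using that *(2) by Groebner_Basis.algebra
  moreover have "P dvd c - d" if "P dvd c - d'" using that *(2) by Groebner_Basis.algebra
  ultimately show "M x y c d'" using *(1) unfolding M_def by blast
next
  fix x y z w assume "K x y z w"
  then obtain l m where lm: "\<not> P dvd x - y" "G l m" "P dvd (z - x) - l * (y - x)" "P dvd (w - x) - m * (y - x)"
    unfolding K_def by blast
  have "P dvd (l - m) * (x - y)" if "P dvd z - w" using that lm(3,4) by Groebner_Basis.algebra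
  then show "\<not> P dvd z - w" using lm(1) G_irrefl[OF lm(2)] dvd_mult_P by blast
next
  fix x y z w assume "D x y z w"
  then show "\<not> P dvd y - z" unfolding D_def by blast
next
  fix x y c d assume "M x y c d"
  then show "\<not> P dvd c - d" unfolding M_def by blast
next
  fix x y z assume "\<not> P dvd x - y" "\<not> P dvd x - z" "\<not> P dvd y - z"
  then show "(\<exists>w. K x y z w) \<or> (\<exists>w. D x y z w)" by (fact pure_ex)
next
  fix x y z w w' assume "K x y z w"
  then show "\<not> D x y z w'" by (fact K_D)
next
  fix x y z w w' assume "K x y z w" "K x y z w'"
  then obtain l m l' m' where lm: "\<not> P dvd x - y" "G l m" "G l' m'"
      "P dvd (z - x) - l * (y - x)" "P dvd (z - x) - l' * (y - x)"
      "P dvd (w - x) - m * (y - x)" "P dvd (w' - x) - m' * (y - x)"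
    unfolding K_def by blast
  have "P dvd l - l'" using K_ratio lm by blast
  then have "P dvd m - m'" using G_unique[OF G_cong[OF lm(2), of l' m] lm(3)] by simp
  then show "P dvd w - w'" using lm(6,7) by Groebner_Basis.algebra
next
  fix x y z w w' assume "D x y z w" "D x y z w'"
  then show "P dvd w - w'" by (fact D_unique)
next
  fix x y c assume "\<not> P dvd x - y"
  then show "(\<exists>z. D x y z c) \<or> (\<exists>d. M x y c d)" by (fact mixed_ex)
next
  fix x y c d z assume "M x y c d"
  then show "\<not> D x y z c" by (fact M_D)
next
  fix x y c d d' assume "M x y c d" "M x y c d'"
  then show "P dvd d - d'" by (fact M_unique)
next
  fix x y z c z' assume "D x y z c" "D x y z' c"
  then show "P dvd z - z'" by (fact D_third_unique)
qed

end

section \<open>Verification of affine families by tables of residues\<close>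

primrec tab_all :: "(int \<Rightarrow> 'a \<Rightarrow> bool) \<Rightarrow> int \<Rightarrow> 'a list \<Rightarrow> bool" where
  "tab_all Q l [] \<longleftrightarrow> True"
| "tab_all Q l (x # xs) \<longleftrightarrow> Q l x \<and> tab_all Q (l + 1) xs"

text \<open>Keeps the simplifier from rewriting the remaining list at every unfolding step.\<close>

lemma tab_all_weak_cong [cong]: "l = l' \<Longrightarrow> tab_all Q l xs \<longleftrightarrow> tab_all Q l' xs"
  by simp

lemma tab_all_iff: "tab_all Q l xs \<longleftrightarrow> (\<forall>i < length xs. Q (l + int i) (xs ! i))"
proof (induction xs arbitrary: l)
  case (Cons x xs)
  have "(\<forall>i < length (x # xs). Q (l + int i) ((x # xs) ! i)) \<longleftrightarrow>
      Q l x \<and> (\<forall>i < length xs. Q (l + 1 + int i) (xs ! i))"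
    unfolding length_Cons All_less_Suc2 by (simp add: add.assoc)
  then show ?case using Cons.IH by simp
qed simp

text \<open>The entry at index \<open>l\<close> is the pair of \<open>m\<close> and \<open>1 / l\<close> modulo \<open>P\<close>, where \<open>{0, 1, l, m}\<close> is a block;
  \<open>m = 0\<close> marks the five values of \<open>l\<close> for which \<open>{0, 1, l}\<close> is degenerate or an arithmetic progression.\<close>

definition table_entry_ok :: "int \<Rightarrow> (int \<Rightarrow> int \<times> int) \<Rightarrow> int \<Rightarrow> int \<times> int \<Rightarrow> bool" where
  "table_entry_ok P T = (\<lambda>l (m, k).
     (m = 0 \<longleftrightarrow> l = 0 \<or> l = 1 \<or> l = 2 \<or> l = P - 1 \<or> 2 * l = P + 1) \<and>
     (m = 0 \<or> 0 < m \<and> m < P \<and> m \<noteq> l \<and> fst (T m) = l \<and> fst (T (P + 1 - l)) = P + 1 - m \<and>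
        0 \<le> k \<and> k < P \<and> l * k mod P = 1 \<and> fst (T k) = m * k mod P))"

text \<open>The check is demanded for every \<open>T\<close> that agrees with the list, so that for
  a concrete table each lookup is a rewrite with a ground equation and not a traversal of the
  list.\<close>

lemma strictly_cyclic_SQS_of_table:
  assumes "prime p" "5 \<le> p" "length xs = p"
    and check: "\<And>T. tab_all (\<lambda>l x. T l = x) 0 xs \<Longrightarrow> tab_all (table_entry_ok (int p) T) 0 xs"
  shows "\<exists>S. strictly_cyclic_SQS 2 p S"
proof -
  define P where "P = int p"
  define T where "T = (\<lambda>l. xs ! nat l)"
  define F where "F = (\<lambda>l. fst (T l))"
  define k where "k = (\<lambda>l. snd (T l))"
  have P: "5 \<le> P" "prime P" using assms(1,2) by (simp_all add: P_def)
  have "tab_all (\<lambda>l x. T l = x) 0 xs" by (simp add: tab_all_iff T_def)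
  then have "tab_all (table_entry_ok P T) 0 xs" unfolding P_def by (rule check)
  then have ok: "table_entry_ok P T l (T l)" if "0 \<le> l" "l < P" for l
    unfolding tab_all_iff T_def using that assms(3) P_def by (metis add_0 nat_0_le of_nat_less_iff)
  have dom: "F l = 0 \<longleftrightarrow> l = 0 \<or> l = 1 \<or> l = 2 \<or> l = P - 1 \<or> 2 * l = P + 1" if "0 \<le> l" "l < P" for l
    using ok[OF that] unfolding table_entry_ok_def F_def by (auto split: prod.splits)
  have entry: "0 < F l" "F l < P" "F l \<noteq> l" "F (F l) = l" "F (P + 1 - l) = P + 1 - F l" "0 \<le> k l" "k l < P"
    "l * k l mod P = 1" "F (k l) = F l * k l mod P" if "0 \<le> l" "l < P" "F l \<noteq> 0" for l
    using ok[OF that(1,2)] that(3) unfolding table_entry_ok_def F_def k_def by (auto split: prod.splits)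
  define G where "G = (\<lambda>l m. F (l mod P) \<noteq> 0 \<and> m mod P = F (l mod P))"
  have mod: "0 \<le> l mod P" "l mod P < P" for l using P by simp_all
  have small: "P dvd l - a \<longleftrightarrow> l mod P = a" if "0 \<le> a" "a < P" for l a
    using that by (simp flip: mod_eq_dvd_iff)
  interpret affine_quadruples p P G
  proof
    show "prime p" "5 \<le> p" "P = int p" using assms(1,2) P_def by simp_all
  next
    fix l m l' m' assume "G l m" "P dvd l - l'" "P dvd m - m'"
    then show "G l' m'" unfolding G_def by (simp flip: mod_eq_dvd_iff)
  next
    fix l m assume G: "G l m"
    then have "F (l mod P) \<noteq> 0" unfolding G_def by simp
    moreover from this have "l mod P \<noteq> 0" using dom[of "l mod P"] mod by simp
    ultimately show "G m l" using G entry(4)[of "l mod P"] mod unfolding G_def by simp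
  next
    fix l m assume G: "G l m"
    define a where "a = l mod P"
    have a: "0 \<le> a" "a < P" "F a \<noteq> 0" "m mod P = F a" using G mod unfolding G_def a_def by simp_all
    \<comment> \<open>This keeps \<open>P + 1 - a\<close> below \<open>P\<close>, so that it is the
      least residue of \<open>1 - a\<close>; the same is needed for \<open>F a\<close>.\<close>
    have a2: "2 \<le> a" using dom[of a] a by auto
    note e = entry[OF a(1-3)]
    have "F (F a) \<noteq> 0" using e(4) a2 by simp
    then have m2: "2 \<le> F a" using dom[of "F a"] e by auto
    have "(1 - l) mod P = (1 - a) mod P" unfolding a_def by (simp add: mod_simps)
    also have "\<dots> = (P + 1 - a) mod P" by (metis add_diff_eq mod_add_self1)
    also have "\<dots> = P + 1 - a" using a a2 by simp
    finally have 1: "(1 - l) mod P = P + 1 - a" .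
    have "(1 - m) mod P = (1 - F a) mod P" using a(4) by (metis mod_diff_right_eq)
    also have "\<dots> = (P + 1 - F a) mod P" by (metis add_diff_eq mod_add_self1)
    also have "\<dots> = P + 1 - F a" using e m2 by simp
    finally show "G (1 - l) (1 - m)" using 1 e unfolding G_def by simp
  next
    fix l m k' assume G: "G l m" and k': "P dvd l * k' - 1"
    define a where "a = l mod P"
    have a: "0 \<le> a" "a < P" "F a \<noteq> 0" "m mod P = F a" using G mod unfolding G_def a_def by simp_all
    note e = entry[OF a(1-3)]
    have la: "P dvd l - a" unfolding a_def by (simp flip: mod_eq_dvd_iff)
    have ka: "P dvd a * k a - 1" using e(8) P by (simp flip: mod_eq_dvd_iff)
    have "P dvd k' - k a" using k' la ka by Groebner_Basis.algebra
    then have kk: "k' mod P = k a" using small e by simp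
    have mk: "(m * k') mod P = F a * k a mod P" using kk a(4) by (metis mod_mult_eq)
    have "\<not> P dvd F a" using e zdvd_not_zless by blast
    moreover have "\<not> P dvd k a"
    proof
      assume "P dvd k a"
      then have "P dvd 1" using ka by Groebner_Basis.algebra
      then show False using P by (simp add: not_prime_unit)
    qed
    \<comment> \<open>The value 0 marks indices outside the domain, so the new entry has to be shown
      nonzero.\<close>
    ultimately have "F a * k a mod P \<noteq> 0" using P(2) by (simp add: prime_dvd_mult_iff flip: dvd_eq_mod_eq_0)
    then show "G k' (m * k')" using kk mk e(9) unfolding G_def by simp
  next
    fix l m assume "G l m"
    then show "\<not> P dvd l - m" using entry(3)[of "l mod P"] mod unfolding G_def
      by (auto simp flip: mod_eq_dvd_iff)
  next
    fix l m m' assume "G l m" "G l m'"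
    then show "P dvd m - m'" unfolding G_def by (simp flip: mod_eq_dvd_iff)
  next
    fix l
    define a where "a = l mod P"
    have a: "0 \<le> a" "a < P" using mod unfolding a_def by simp_all
    have la: "P dvd l - a" unfolding a_def by (simp flip: mod_eq_dvd_iff)
    have "(\<exists>m. G l m) \<longleftrightarrow> F a \<noteq> 0"
    proof
      assume "F a \<noteq> 0"
      then have "G l (F a)" using entry[OF a] unfolding G_def a_def by simp
      then show "\<exists>m. G l m" ..
    qed (auto simp: G_def a_def)
    moreover have "P dvd l + 1 \<longleftrightarrow> a = P - 1"
    proof -
      have "P dvd l + 1 \<longleftrightarrow> P dvd l - (P - 1)"
        by (metis add_diff_eq diff_add_eq dvd_add_triv_right_iff diff_diff_eq2 diff_add_cancel add.commute)
      then show ?thesis using small[of "P - 1" l] P a_def by simp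
    qed
    moreover have "P dvd 2 * l - 1 \<longleftrightarrow> 2 * a = P + 1"
    proof
      assume "P dvd 2 * l - 1"
      then have "P dvd 2 * a - 1" using la by Groebner_Basis.algebra
      then obtain q where q: "2 * a - 1 = P * q" by blast
      \<comment> \<open>\<open>2 * a - 1\<close> is odd and lies strictly between \<open>- P\<close>
        and \<open>2 * P\<close>, which leaves only \<open>q = 1\<close>.\<close>
      have "odd (P * q)" unfolding q[symmetric] by simp
      then have "q \<noteq> 0" by auto
      moreover have "\<not> q < 0"
      proof
        assume "q < 0"
        then have "P * q \<le> P * (-1)" using P by (intro mult_left_mono) simp_all
        then have "2 * a - 1 \<le> - P" using q by simp
        then show False using a P by simp
      qed
      moreover have "q < 2"
      proof (rule ccontr)
        assume "\<not> q < 2"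
        then have "P * 2 \<le> P * q" using P by (intro mult_left_mono) simp_all
        then have "P * 2 \<le> 2 * a - 1" using q by simp
        then show False using a by simp
      qed
      ultimately have "q = 1" by simp
      then show "2 * a = P + 1" using q by simp
    next
      assume "2 * a = P + 1"
      then show "P dvd 2 * l - 1" using la by Groebner_Basis.algebra
    qed
    ultimately show "(\<exists>m. G l m) \<longleftrightarrow>
        \<not> P dvd l \<and> \<not> P dvd l - 1 \<and> \<not> P dvd l + 1 \<and> \<not> P dvd l - 2 \<and> \<not> P dvd 2 * l - 1"
      using dom[OF a] small[of 0 l] small[of 1 l] small[of 2 l] P unfolding a_def[symmetric] by auto
  qed
  show ?thesis using strictly_cyclic_blocks by blast
qed

section \<open>The eight exceptional primes\<close>

text \<open>Here \<open>e = 11\<close> and \<open>(1 + e) / 3 = 4\<close> modulo 37, so entries 11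
  and 4 refer to each other; entry 3 shows the block on 0, 1, 3, 35 of the form 0, 1,
  \<open>a\<close>, \<open>1 - a\<close>. In the tables for 61, 73, 109, 157, 181, 229 and 277, the
  entry of \<open>(1 + e) / 3\<close> stands at \<open>e\<close> = 14, 9, 46, 13, 49, 95 and 117
  respectively.\<close>

definition table_37 :: "(int \<times> int) list" where
  "table_37 = [
    (0,0), (0,1), (0,19), (35,25), (11,28), (6,15), (5,31), (31,16), (30,14), (29,33), (26,26),
    (4,27), (28,34), (14,20), (13,8), (16,5), (15,7), (18,24), (17,35), (0,2), (21,13), (20,30),
    (23,32), (22,29), (25,17), (24,3), (10,10), (34,11), (12,4), (9,23), (8,21), (7,6), (33,22),
    (32,9), (27,12), (3,18), (0,36)]"

lemma strictly_cyclic_SQS_37: "\<exists>S. strictly_cyclic_SQS 2 37 S"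
proof (rule strictly_cyclic_SQS_of_table[where xs = table_37])
  fix T assume T: "tab_all (\<lambda>l x. T l = x) 0 table_37"
  \<comment> \<open>Simplification splits the table into one equation \<open>T l = (m, k)\<close>
    per index; these rewrite all lookups in the check below.\<close>
  note T_eqs = T[unfolded table_37_def, simplified]
  show "tab_all (table_entry_ok (int 37) T) 0 table_37"
    unfolding table_37_def table_entry_ok_def of_nat_numeral by (simp add: T_eqs)
qed (simp_all add: table_37_def)

definition table_61 :: "(int \<times> int) list" where
  "table_61 = [
    (0,0), (0,1), (0,31), (59,41), (58,46), (14,49), (7,51), (6,35), (9,23), (8,34), (11,55),
    (10,50), (50,56), (47,47), (5,48), (49,57), (17,42), (16,18), (44,17), (20,45), (19,58),
    (22,32), (21,25), (24,8), (23,28), (37,22), (36,54), (35,52), (34,24), (30,40), (29,59),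
    (0,2), (33,21), (32,37), (28,9), (27,7), (26,39), (25,33), (39,53), (38,36), (41,29), (40,3),
    (43,16), (42,44), (18,43), (46,19), (45,4), (13,13), (57,14), (15,5), (12,11), (52,6),
    (51,27), (54,38), (53,26), (56,10), (55,12), (48,15), (4,20), (3,30), (0,60)]"

lemma strictly_cyclic_SQS_61: "\<exists>S. strictly_cyclic_SQS 2 61 S"
proof (rule strictly_cyclic_SQS_of_table[where xs = table_61])
  fix T assume T: "tab_all (\<lambda>l x. T l = x) 0 table_61"
  note T_eqs = T[unfolded table_61_def, simplified]
  show "tab_all (table_entry_ok (int 61) T) 0 table_61"
    unfolding table_61_def table_entry_ok_def of_nat_numeral by (simp add: T_eqs)
qed (simp_all add: table_61_def)

definition table_73 :: "(int \<times> int) list" where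
  "table_73 = [
    (0,0), (0,1), (0,37), (4,49), (3,55), (69,44), (68,61), (67,21), (64,64), (52,65), (66,22),
    (12,20), (11,67), (14,45), (13,47), (16,39), (15,32), (18,43), (17,69), (55,50), (21,11),
    (20,7), (65,10), (51,54), (25,70), (24,38), (48,59), (47,46), (29,60), (28,68), (31,56),
    (30,33), (42,16), (41,31), (35,58), (34,48), (38,71), (0,2), (36,25), (40,15), (39,42),
    (33,57), (32,40), (44,17), (43,5), (46,13), (45,27), (27,14), (26,35), (50,3), (49,19),
    (23,63), (9,66), (54,62), (53,23), (19,4), (57,30), (56,41), (59,34), (58,26), (61,28),
    (60,6), (63,53), (62,51), (8,8), (22,9), (10,52), (7,12), (6,29), (5,18), (71,24), (70,36),
    (0,72)]"

lemma strictly_cyclic_SQS_73: "\<exists>S. strictly_cyclic_SQS 2 73 S"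
proof (rule strictly_cyclic_SQS_of_table[where xs = table_73])
  fix T assume T: "tab_all (\<lambda>l x. T l = x) 0 table_73"
  note T_eqs = T[unfolded table_73_def, simplified]
  show "tab_all (table_entry_ok (int 73) T) 0 table_73"
    unfolding table_73_def table_entry_ok_def of_nat_numeral by (simp add: T_eqs)
qed (simp_all add: table_73_def)

definition table_109 :: "(int \<times> int) list" where
  "table_109 = [
    (0,0), (0,1), (0,55), (107,73), (5,82), (4,22), (104,91), (8,78), (7,41), (10,97), (9,11),
    (99,10), (13,100), (12,42), (15,39), (14,80), (17,75), (16,77), (92,103), (20,23), (19,60),
    (89,26), (88,5), (24,19), (23,50), (26,48), (25,21), (28,105), (27,74), (81,94), (80,40),
    (32,102), (31,92), (77,76), (35,93), (34,81), (74,106), (38,56), (37,66), (40,14), (39,30),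
    (69,8), (68,13), (67,71), (66,57), (63,63), (52,64), (65,58), (49,25), (48,89), (60,24),
    (59,62), (46,65), (54,72), (53,107), (0,2), (57,37), (56,44), (64,47), (51,85), (50,20),
    (62,84), (61,51), (45,45), (58,46), (47,52), (44,38), (43,96), (42,101), (41,79), (71,95),
    (70,43), (73,53), (72,3), (36,28), (76,16), (75,33), (33,17), (79,7), (78,69), (30,15),
    (29,35), (83,4), (82,88), (85,61), (84,59), (87,90), (86,104), (22,83), (21,49), (91,86),
    (90,6), (18,32), (94,34), (93,29), (96,70), (95,67), (98,9), (97,99), (11,98), (101,12),
    (100,68), (103,31), (102,18), (6,87), (106,27), (105,36), (3,54), (0,108)]"

lemma strictly_cyclic_SQS_109: "\<exists>S. strictly_cyclic_SQS 2 109 S"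
proof (rule strictly_cyclic_SQS_of_table[where xs = table_109])
  fix T assume T: "tab_all (\<lambda>l x. T l = x) 0 table_109"
  note T_eqs = T[unfolded table_109_def, simplified]
  show "tab_all (table_entry_ok (int 109) T) 0 table_109"
    unfolding table_109_def table_entry_ok_def of_nat_numeral by (simp add: T_eqs)
qed (simp_all add: table_109_def)

definition table_157 :: "(int \<times> int) list" where
  "table_157 = [
    (0,0), (0,1), (0,79), (4,105), (3,118), (6,63), (5,131), (151,45), (150,59), (10,35), (9,110),
    (147,100), (144,144), (57,145), (146,101), (143,21), (17,108), (16,37), (19,96), (18,124),
    (21,55), (20,15), (136,50), (24,41), (23,72), (26,44), (25,151), (131,64), (130,129), (30,65),
    (29,89), (32,76), (31,54), (125,138), (124,97), (36,9), (35,48), (121,17), (120,62),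
    (119,153), (118,106), (42,23), (41,86), (115,84), (45,25), (44,7), (47,99), (46,147),
    (110,36), (50,141), (49,22), (107,117), (53,154), (52,80), (104,32), (56,20), (55,143),
    (13,146), (59,111), (58,8), (98,123), (62,139), (61,38), (64,5), (63,27), (66,29), (65,69),
    (91,75), (90,127), (89,66), (71,83), (70,115), (86,24), (85,114), (75,87), (74,67), (77,31),
    (76,104), (80,155), (0,2), (78,53), (82,126), (81,90), (84,70), (83,43), (73,133), (72,42),
    (88,74), (87,91), (69,30), (68,82), (67,88), (93,128), (92,130), (95,152), (94,119), (97,18),
    (96,34), (60,149), (100,46), (99,11), (145,14), (103,137), (102,125), (54,77), (106,3),
    (105,40), (51,135), (109,16), (108,121), (48,10), (112,58), (111,150), (114,132), (113,73),
    (43,71), (117,134), (116,51), (40,4), (39,95), (38,140), (37,109), (123,148), (122,60),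
    (34,19), (33,103), (127,81), (126,68), (129,92), (128,28), (28,93), (27,6), (133,113),
    (132,85), (135,116), (134,107), (22,142), (138,102), (137,33), (140,61), (139,120), (142,49),
    (141,136), (15,56), (12,12), (101,13), (14,57), (11,47), (149,122), (148,98), (8,112), (7,26),
    (153,94), (152,39), (155,52), (154,78), (0,156)]"

lemma strictly_cyclic_SQS_157: "\<exists>S. strictly_cyclic_SQS 2 157 S"
proof (rule strictly_cyclic_SQS_of_table[where xs = table_157])
  fix T assume T: "tab_all (\<lambda>l x. T l = x) 0 table_157"
  note T_eqs = T[unfolded table_157_def, simplified]
  show "tab_all (table_entry_ok (int 157) T) 0 table_157"
    unfolding table_157_def table_entry_ok_def of_nat_numeral by (simp add: T_eqs)
qed (simp_all add: table_157_def)

definition table_181 :: "(int \<times> int) list" where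
  "table_181 = [
    (0,0), (0,1), (0,91), (179,121), (178,136), (177,145), (176,151), (175,26), (174,68),
    (173,161), (11,163), (10,33), (13,166), (12,14), (168,13), (16,169), (15,34), (165,32),
    (19,171), (18,162), (162,172), (22,69), (21,107), (24,63), (23,83), (26,29), (25,7), (28,114),
    (27,97), (30,25), (29,175), (32,146), (31,17), (149,11), (148,16), (36,150), (35,176),
    (38,137), (37,81), (40,65), (39,86), (42,53), (41,125), (139,80), (45,144), (44,177),
    (47,122), (46,104), (132,132), (77,133), (134,105), (52,71), (51,94), (54,41), (53,57),
    (56,79), (55,139), (125,54), (124,103), (60,135), (59,178), (62,92), (61,73), (64,23),
    (63,99), (66,39), (65,96), (68,154), (67,8), (70,21), (69,75), (72,51), (71,88), (109,62),
    (108,159), (107,70), (106,131), (49,134), (104,123), (80,55), (79,43), (101,38), (100,117),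
    (99,24), (98,153), (97,115), (96,40), (95,129), (94,72), (90,120), (89,179), (0,2), (93,61),
    (92,109), (88,52), (87,141), (86,66), (85,28), (84,157), (83,64), (82,143), (81,138),
    (103,126), (102,58), (78,47), (133,50), (76,111), (75,22), (74,119), (73,93), (111,130),
    (110,106), (113,160), (112,173), (115,27), (114,85), (117,142), (116,82), (119,158),
    (118,108), (121,89), (120,3), (123,46), (122,78), (58,127), (57,42), (127,102), (126,124),
    (129,140), (128,87), (131,110), (130,76), (48,48), (105,49), (50,77), (136,59), (135,4),
    (138,37), (137,101), (43,56), (141,128), (140,95), (143,116), (142,100), (145,44), (144,5),
    (147,31), (146,165), (34,170), (33,164), (151,35), (150,6), (153,156), (152,84), (155,67),
    (154,174), (157,152), (156,98), (159,118), (158,74), (161,112), (160,9), (20,19), (164,10),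
    (163,149), (17,147), (167,12), (166,168), (14,167), (170,15), (169,148), (172,18), (171,20),
    (9,113), (8,155), (7,30), (6,36), (5,45), (4,60), (3,90), (0,180)]"

lemma strictly_cyclic_SQS_181: "\<exists>S. strictly_cyclic_SQS 2 181 S"
proof (rule strictly_cyclic_SQS_of_table[where xs = table_181])
  fix T assume T: "tab_all (\<lambda>l x. T l = x) 0 table_181"
  note T_eqs = T[unfolded table_181_def, simplified]
  show "tab_all (table_entry_ok (int 181) T) 0 table_181"
    unfolding table_181_def table_entry_ok_def of_nat_numeral by (simp add: T_eqs)
qed (simp_all add: table_181_def)

definition table_229 :: "(int \<times> int) list" where
  "table_229 = [
    (0,0), (0,1), (0,115), (4,153), (3,172), (225,46), (224,191), (223,131), (222,86), (10,51),
    (9,23), (219,125), (218,210), (14,141), (13,180), (16,168), (15,43), (18,27), (17,140),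
    (211,217), (21,126), (20,120), (208,177), (207,10), (25,105), (24,55), (204,185), (28,17),
    (27,90), (201,79), (200,84), (199,133), (95,136), (34,118), (33,128), (36,72), (35,70),
    (38,130), (37,223), (40,47), (39,63), (189,162), (188,60), (187,16), (186,203), (46,56),
    (45,5), (48,39), (47,167), (181,215), (180,142), (52,9), (51,207), (54,121), (53,123),
    (175,25), (57,45), (56,225), (172,154), (60,66), (59,42), (62,214), (61,181), (167,40),
    (65,68), (64,74), (67,59), (66,188), (69,64), (68,156), (160,36), (159,100), (73,35),
    (72,160), (156,65), (155,171), (77,226), (76,116), (79,138), (78,29), (81,146), (80,82),
    (148,81), (84,149), (83,30), (86,97), (85,8), (143,179), (89,216), (88,211), (140,28),
    (92,151), (91,117), (137,197), (134,134), (32,135), (136,198), (98,85), (97,222), (100,192),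
    (99,71), (129,195), (128,119), (104,209), (103,218), (106,24), (105,175), (123,122),
    (109,176), (108,208), (120,127), (112,196), (111,137), (117,152), (116,227), (0,2), (114,77),
    (113,92), (119,33), (118,102), (110,21), (122,53), (121,107), (107,54), (125,205), (124,11),
    (127,20), (126,110), (102,34), (101,158), (131,37), (130,7), (133,144), (132,31), (94,94),
    (198,95), (96,32), (93,112), (139,78), (138,201), (90,18), (142,13), (141,50), (87,221),
    (145,132), (144,199), (147,80), (146,148), (82,147), (150,83), (149,200), (152,91), (151,113),
    (154,3), (153,58), (75,164), (74,69), (158,194), (157,129), (71,193), (70,73), (162,165),
    (161,41), (164,170), (163,155), (166,161), (165,189), (63,48), (169,15), (168,187), (171,163),
    (170,75), (58,4), (174,184), (173,204), (55,106), (177,108), (176,22), (179,220), (178,87),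
    (50,14), (49,62), (183,190), (182,224), (185,173), (184,26), (44,213), (43,169), (42,67),
    (41,166), (191,182), (190,6), (193,99), (192,159), (195,157), (194,101), (197,111), (196,93),
    (135,96), (31,145), (30,150), (29,139), (203,212), (202,44), (26,174), (206,124), (205,219),
    (23,52), (22,109), (210,103), (209,12), (19,89), (213,202), (212,186), (215,61), (214,49),
    (217,88), (216,19), (12,104), (11,206), (221,178), (220,143), (8,98), (7,38), (6,183), (5,57),
    (227,76), (226,114), (0,228)]"

lemma strictly_cyclic_SQS_229: "\<exists>S. strictly_cyclic_SQS 2 229 S"
proof (rule strictly_cyclic_SQS_of_table[where xs = table_229])
  fix T assume T: "tab_all (\<lambda>l x. T l = x) 0 table_229"
  note T_eqs = T[unfolded table_229_def, simplified]
  show "tab_all (table_entry_ok (int 229) T) 0 table_229"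
    unfolding table_229_def table_entry_ok_def of_nat_numeral by (simp add: T_eqs)
qed (simp_all add: table_229_def)

definition table_277 :: "(int \<times> int) list" where
  "table_277 = [
    (0,0), (0,1), (0,139), (275,185), (274,208), (273,111), (7,231), (6,198), (9,104), (8,154),
    (268,194), (12,126), (11,254), (14,64), (13,99), (263,37), (17,52), (16,163), (260,77),
    (20,175), (19,97), (22,66), (21,63), (255,265), (254,127), (26,133), (25,32), (28,236),
    (27,188), (30,86), (29,157), (247,143), (246,26), (245,42), (35,220), (34,95), (37,177),
    (36,15), (240,226), (239,206), (238,187), (42,250), (41,33), (235,58), (234,170), (233,197),
    (47,271), (46,112), (230,202), (229,147), (51,205), (50,239), (53,16), (52,115), (161,118),
    (223,136), (222,94), (58,243), (57,43), (60,108), (59,217), (217,109), (216,210), (215,22),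
    (65,13), (64,179), (67,21), (66,215), (69,110), (68,273), (71,186), (70,238), (73,227),
    (72,148), (75,146), (74,229), (77,113), (76,18), (200,103), (199,270), (198,232), (82,171),
    (81,125), (195,267), (85,155), (84,88), (87,29), (86,121), (190,85), (189,249), (188,237),
    (92,207), (91,274), (94,140), (93,56), (183,35), (182,101), (181,20), (180,212), (179,14),
    (101,241), (100,96), (103,258), (102,78), (105,8), (104,124), (107,196), (106,233), (109,59),
    (108,61), (111,68), (110,5), (166,47), (114,76), (113,260), (163,53), (160,160), (224,161),
    (162,54), (120,142), (119,247), (157,87), (123,193), (122,268), (154,105), (153,82), (127,11),
    (126,24), (150,145), (149,204), (148,228), (132,203), (131,149), (134,25), (133,246),
    (136,158), (135,55), (138,184), (137,275), (0,2), (141,93), (140,222), (143,119), (142,31),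
    (145,252), (144,128), (147,74), (146,49), (130,73), (129,132), (128,253), (152,266),
    (151,195), (125,172), (124,9), (156,84), (155,190), (121,30), (159,135), (158,223), (116,116),
    (54,117), (118,224), (115,17), (165,201), (164,230), (112,272), (168,209), (167,216),
    (170,218), (169,44), (172,81), (171,153), (174,269), (173,199), (176,19), (175,181), (178,36),
    (177,263), (99,65), (98,257), (97,176), (96,242), (95,221), (185,137), (184,3), (187,70),
    (186,40), (90,28), (89,192), (88,156), (192,248), (191,189), (194,122), (193,10), (83,152),
    (197,106), (196,45), (80,7), (79,174), (78,259), (202,164), (201,48), (204,131), (203,129),
    (206,50), (205,39), (208,91), (207,4), (210,167), (209,62), (212,256), (211,98), (214,264),
    (213,255), (63,67), (62,168), (61,60), (219,169), (218,234), (221,34), (220,183), (56,141),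
    (55,159), (117,162), (226,261), (225,38), (228,72), (227,130), (49,75), (48,165), (232,6),
    (231,80), (45,107), (44,219), (43,244), (237,27), (236,90), (40,71), (39,51), (38,262),
    (242,100), (241,182), (244,57), (243,235), (33,251), (32,134), (31,120), (249,191), (248,89),
    (251,41), (250,245), (253,144), (252,150), (24,12), (23,214), (257,211), (256,180), (259,102),
    (258,200), (18,114), (262,225), (261,240), (15,178), (265,213), (264,23), (267,151), (266,83),
    (10,123), (270,173), (269,79), (272,46), (271,166), (5,69), (4,92), (3,138), (0,276)]"

lemma strictly_cyclic_SQS_277: "\<exists>S. strictly_cyclic_SQS 2 277 S"
proof (rule strictly_cyclic_SQS_of_table[where xs = table_277])
  fix T assume T: "tab_all (\<lambda>l x. T l = x) 0 table_277"
  note T_eqs = T[unfolded table_277_def, simplified]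
  show "tab_all (table_entry_ok (int 277) T) 0 table_277"
    unfolding table_277_def table_entry_ok_def of_nat_numeral by (simp add: T_eqs)
qed (simp_all add: table_277_def)

theorem theorem4p5:
  fixes p :: nat
  assumes "(prime p \<and> p mod 12 = 7) \<or> p \<in> {37, 61, 73, 109, 157, 181, 229, 277}"
  shows "(\<exists>S. strictly_cyclic_SQS 2 p S) \<and> (\<exists>C. perfect_OOC2D 2 p C)"
proof -
  have "\<exists>S. strictly_cyclic_SQS 2 p S"
    using assms strictly_cyclic_SQS_7_mod_12 strictly_cyclic_SQS_37 strictly_cyclic_SQS_61
      strictly_cyclic_SQS_73 strictly_cyclic_SQS_109 strictly_cyclic_SQS_157 strictly_cyclic_SQS_181
      strictly_cyclic_SQS_229 strictly_cyclic_SQS_277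
    by blast
  moreover have "0 < p" using assms by (auto intro: prime_gt_0_nat)
  ultimately show ?thesis using perfect_OOC2D_of_strictly_cyclic_SQS by blast
qed

end
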